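(* For each $\lambda>0$, $\beta>0$ and for each odd $K$ and $L$ such that $KL>K^*=5/\lambda$, the process $\mathcal{M}_{K,L}$ on the torus $\mathcal{T}_{KL}$ (with total exogenous arrival rate $\lambda$ per node, service rate $1$ and swap rate $\beta$) is transient.
   Context: Let $K,L\ge3$ be odd and let $\mathcal{T}_{KL}=(V_{KL},E)$ be the discrete torus $\mathbb{Z}/K\mathbb{Z}\times\mathbb{Z}/L\mathbb{Z}$ with nearest-neighbor edges, with graph distance $\mathrm{dist}$. At each node there is one server with a FIFO queue, described by the finite word of destinations (elements of $V_{KL}$) of its customers, listed in order of arrival. $\mathcal{M}_{K,L}$ is the continuous-time Markov process on the countable set of queue configurations with the following dynamics. (Arrivals) With rate $\lambda_{v,w}\ge0$, an exogenous customer with destination $w$ arrives at node $v$ and joins the end of its queue; $\lambda_{v,w}$ depends only on $w-v$ in the group $\mathbb{Z}/K\mathbb{Z}\times\mathbb{Z}/L\mathbb{Z}$, and $\lambda=\sum_w\lambda_{v,w}$ is the total exogenous rate at each node. (Services) Each node has an independent Poisson clock of rate $1$. When the clock at $v$ rings and the queue at $v$ is nonempty, its first customer $c$, with destination $D(c)$, completes its service. If $\mathrm{dist}(v,D(c))\le1$ it leaves the network; otherwise it joins the end of the queue at a node chosen uniformly among the neighbors $w$ of $v$ with $\mathrm{dist}(w,D(c))=\mathrm{dist}(v,D(c))-1$. (Swaps) Each edge has an independent Poisson clock of rate $\beta$; when it rings, the two servers at its endpoints exchange positions together with their whole queues. Transience is in the usual sense for continuous-time Markov chains on a countable state space. *)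

theory Defs
  imports
    "HOL-Probability.Probability"
    "HOL-Combinatorics.Transposition"
    "Berlekamp_Zassenhaus.Finite_Field"
begin

section \<open>Continuous-time Markov chains on a countable state space\<close>

text \<open>
  A chain is given by its transition rates \<open>q x y\<close> for \<open>x \<noteq> y\<close>; the values \<open>q x x\<close> are never used.
  The path measure is the jump chain / holding time construction of the (minimal) chain: if \<open>Y\<close> is
  the embedded discrete-time chain and \<open>T 0, T 1, \<dots>\<close> are independent exponential variables of
  rate 1, independent of \<open>Y\<close>, then the \<open>n\<close>-th holding time is \<open>T n\<close> divided by the exit rate
  of \<open>Y n\<close> (and is infinite if \<open>Y n\<close> is absorbing).
\<close>

definition exit_rate :: "('s \<Rightarrow> 's \<Rightarrow> real) \<Rightarrow> 's \<Rightarrow> real" where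
  "exit_rate q x = (\<Sum>\<^sub>\<infinity>y\<in>-{x}. q x y)"

definition jump_pmf :: "('s \<Rightarrow> 's \<Rightarrow> real) \<Rightarrow> 's \<Rightarrow> 's pmf" where
  "jump_pmf q x =
    (if exit_rate q x = 0 then return_pmf x
     else embed_pmf (\<lambda>y. if y = x then 0 else q x y / exit_rate q x))"

definition jump_kernel :: "('s \<Rightarrow> 's \<Rightarrow> real) \<Rightarrow> 's \<Rightarrow> nat \<Rightarrow> (nat \<Rightarrow> 's) \<Rightarrow> 's measure" where
  "jump_kernel q x n \<omega> =
    measure_pmf (case n of 0 \<Rightarrow> return_pmf x | Suc m \<Rightarrow> jump_pmf q (\<omega> m))"

text \<open>The Ionescu-Tulcea measure of the kernels \<open>jump_kernel q x\<close>.\<close>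

definition jump_chain :: "('s::countable \<Rightarrow> 's \<Rightarrow> real) \<Rightarrow> 's \<Rightarrow> (nat \<Rightarrow> 's) measure" where
  "jump_chain q x =
    projective_family.lim UNIV
      (Ionescu_Tulcea.CI (jump_kernel q x) (\<lambda>_. count_space UNIV)) (\<lambda>_. count_space UNIV)"

definition ctmc :: "('s::countable \<Rightarrow> 's \<Rightarrow> real) \<Rightarrow> 's \<Rightarrow> ((nat \<Rightarrow> 's) \<times> (nat \<Rightarrow> real)) measure" where
  "ctmc q x =
    jump_chain q x \<Otimes>\<^sub>M PiM UNIV (\<lambda>_. density lborel (\<lambda>t. ennreal (exponential_density 1 t)))"

fun jump_time :: "('s \<Rightarrow> 's \<Rightarrow> real) \<Rightarrow> (nat \<Rightarrow> 's) \<times> (nat \<Rightarrow> real) \<Rightarrow> nat \<Rightarrow> ennreal" where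
  "jump_time q (Y, T) n = (\<Sum>i<n. ennreal (T i) / ennreal (exit_rate q (Y i)))"

text \<open>The state at time \<open>t\<close>; \<open>None\<close> is the cemetery, entered at the explosion time (if any).\<close>

definition ctmc_at ::
  "('s \<Rightarrow> 's \<Rightarrow> real) \<Rightarrow> (nat \<Rightarrow> 's) \<times> (nat \<Rightarrow> real) \<Rightarrow> real \<Rightarrow> 's option" where
  "ctmc_at q \<omega> t =
    (if \<exists>n. jump_time q \<omega> n \<le> ennreal t \<and> ennreal t < jump_time q \<omega> (Suc n)
     then Some (fst \<omega> (THE n. jump_time q \<omega> n \<le> ennreal t \<and> ennreal t < jump_time q \<omega> (Suc n)))
     else None)"

definition transient_state :: "('s::countable \<Rightarrow> 's \<Rightarrow> real) \<Rightarrow> 's \<Rightarrow> bool" where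
  "transient_state q x \<longleftrightarrow> (AE \<omega> in ctmc q x. bdd_above {t. 0 \<le> t \<and> ctmc_at q \<omega> t = Some x})"

definition transient_ctmc :: "('s::countable \<Rightarrow> 's \<Rightarrow> real) \<Rightarrow> bool" where
  "transient_ctmc q \<longleftrightarrow> (\<forall>x. transient_state q x)"

lemma jump_kernel_Ionescu_Tulcea:
  fixes q :: "'s::countable \<Rightarrow> 's \<Rightarrow> real"
  shows "Ionescu_Tulcea (jump_kernel q x) (\<lambda>_. count_space UNIV)"
proof (rule Ionescu_Tulcea.intro)
  fix n :: nat
  show "jump_kernel q x n \<in> measurable (PiM {0..<n} (\<lambda>_. count_space UNIV))
          (subprob_algebra (count_space UNIV))"
  proof (cases n)
    case 0
    then show ?thesis
      by (simp add: jump_kernel_def[abs_def] space_subprob_algebra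
            measure_pmf.subprob_space_axioms)
  next
    case (Suc m)
    have "(\<lambda>\<omega>. \<omega> m) \<in> measurable (PiM {0..<n} (\<lambda>_. count_space (UNIV::'s set))) (count_space UNIV)"
      using Suc by (intro measurable_component_singleton) auto
    moreover have "(\<lambda>y. measure_pmf (jump_pmf q y)) \<in>
        measurable (count_space UNIV) (subprob_algebra (count_space UNIV))"
      by (auto simp: space_subprob_algebra measure_pmf.subprob_space_axioms)
    ultimately show ?thesis
      using Suc by (simp add: jump_kernel_def[abs_def] measurable_compose[of "\<lambda>\<omega>. \<omega> m"])
  qed
next
  fix n \<omega>
  show "prob_space (jump_kernel q x n \<omega>)"
    by (simp add: jump_kernel_def measure_pmf.prob_space_axioms)
qed

lemma pmf_jump_pmf:
  assumes nonneg: "\<And>y. y \<noteq> x \<Longrightarrow> 0 \<le> q x y"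
    and fin: "finite {y. y \<noteq> x \<and> q x y \<noteq> 0}"
    and pos: "exit_rate q x \<noteq> 0"
  shows "pmf (jump_pmf q x) y = (if y = x then 0 else q x y / exit_rate q x)"
proof -
  let ?A = "{y. y \<noteq> x \<and> q x y \<noteq> 0}"
  let ?f = "\<lambda>y. if y = x then 0 else q x y / exit_rate q x"
  have ex: "exit_rate q x = (\<Sum>y\<in>?A. q x y)"
    unfolding exit_rate_def
    by (subst infsum_cong_neutral[where T = ?A and g = "q x"]) (auto simp: fin)
  have "exit_rate q x \<ge> 0"
    unfolding ex using nonneg by (auto intro: sum_nonneg)
  then have f0: "?f y \<ge> 0" for y
    using nonneg[of y] by simp
  have "(\<integral>\<^sup>+y. ennreal (?f y) \<partial>count_space UNIV) = (\<Sum>y\<in>?A. ennreal (?f y))"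
    by (rule nn_integral_count_space'[OF fin]) (auto split: if_splits)
  also have "\<dots> = ennreal (\<Sum>y\<in>?A. ?f y)"
    by (rule sum_ennreal) (rule f0)
  also have "(\<Sum>y\<in>?A. ?f y) = (\<Sum>y\<in>?A. q x y) / exit_rate q x"
    unfolding sum_divide_distrib by (intro sum.cong) auto
  also have "\<dots> = 1"
    using pos by (simp add: ex)
  finally show ?thesis
    using pmf_embed_pmf[of ?f y] f0 pos by (simp add: jump_pmf_def)
qed


section \<open>The discrete torus\<close>

text \<open>The group \<open>Z/KZ \<times> Z/LZ\<close> with \<open>K = CARD('k)\<close> and \<open>L = CARD('l)\<close>.\<close>

type_synonym ('k, 'l) torus = "'k mod_ring \<times> 'l mod_ring"

definition adj :: "('k::nontriv, 'l::nontriv) torus \<Rightarrow> ('k, 'l) torus \<Rightarrow> bool" where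
  "adj v w \<longleftrightarrow> w - v \<in> {(1, 0), (- 1, 0), (0, 1), (0, - 1)}"

definition torus_edges :: "('k::nontriv, 'l::nontriv) torus set set" where
  "torus_edges = {{v, w} | v w. adj v w}"

definition torus_dist :: "('k::nontriv, 'l::nontriv) torus \<Rightarrow> ('k, 'l) torus \<Rightarrow> nat" where
  "torus_dist v w = (LEAST n. (v, w) \<in> {(a, b). adj a b} ^^ n)"


section \<open>The queueing network with swaps\<close>

text \<open>
  A configuration assigns to each node the list of the destinations of the customers queueing there,
  the customer in service (the oldest one) being the head of the list.
\<close>

type_synonym ('k, 'l) config = "('k, 'l) torus \<Rightarrow> ('k, 'l) torus list"

text \<open>Law of the configuration after a service completion at \<open>v\<close>, when the queue at \<open>v\<close> is nonempty.\<close>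

definition service_pmf ::
  "('k::nontriv, 'l::nontriv) torus \<Rightarrow> ('k, 'l) config \<Rightarrow> ('k, 'l) config pmf" where
  "service_pmf v \<eta> =
    (let d = hd (\<eta> v); \<eta>' = \<eta>(v := tl (\<eta> v)) in
     if torus_dist v d \<le> 1 then return_pmf \<eta>'
     else map_pmf (\<lambda>w. \<eta>'(w := \<eta>' w @ [d]))
            (pmf_of_set {w. adj v w \<and> torus_dist w d + 1 = torus_dist v d}))"

text \<open>
  Rate of the transition from \<open>\<eta>\<close> to \<open>\<zeta> \<noteq> \<eta>\<close>: the sum over all Poisson clocks of their rate times
  the probability that a ring turns \<open>\<eta>\<close> into \<open>\<zeta>\<close>. In the last summand the edges are unordered
  pairs, and exchanging the two queues does not depend on the order of the endpoints.
\<close>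

definition network_rate ::
  "(('k::nontriv, 'l::nontriv) torus \<Rightarrow> ('k, 'l) torus \<Rightarrow> real) \<Rightarrow> real
    \<Rightarrow> ('k, 'l) config \<Rightarrow> ('k, 'l) config \<Rightarrow> real" where
  "network_rate arr \<beta> \<eta> \<zeta> =
     (\<Sum>v\<in>UNIV. \<Sum>w\<in>UNIV. arr v w * of_bool (\<zeta> = \<eta>(v := \<eta> v @ [w])))
   + (\<Sum>v | \<eta> v \<noteq> []. pmf (service_pmf v \<eta>) \<zeta>)
   + \<beta> * real (card {e \<in> torus_edges. \<exists>v w. e = {v, w} \<and> v \<noteq> w \<and> \<zeta> = \<eta> \<circ> Transposition.transpose v w})"

lemma finite_network_rate_support: "finite {\<zeta>. network_rate arr \<beta> \<eta> \<zeta> \<noteq> 0}"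
proof -
  let ?A = "\<Union>v. \<Union>w. {\<eta>(v := \<eta> v @ [w])}"
  let ?S = "\<Union>v\<in>{v. \<eta> v \<noteq> []}. set_pmf (service_pmf v \<eta>)"
  let ?E = "\<Union>v. \<Union>w. {\<eta> \<circ> Transposition.transpose v w}"
  have "finite (set_pmf (service_pmf v \<eta>))" for v
  proof -
    let ?\<eta> = "\<eta>(v := tl (\<eta> v))"
    have "set_pmf (service_pmf v \<eta>) \<subseteq>
        insert ?\<eta> (range (\<lambda>w. ?\<eta>(w := ?\<eta> w @ [hd (\<eta> v)])))"
      unfolding service_pmf_def Let_def
      by (cases "torus_dist v (hd (\<eta> v)) \<le> 1") (simp_all add: image_mono subset_insertI2)
    then show ?thesis
      by (rule finite_subset) simp
  qed
  then have fin: "finite (?A \<union> ?S \<union> ?E)"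
    by (intro finite_UnI finite_UN_I) auto
  have "network_rate arr \<beta> \<eta> \<zeta> = 0" if "\<zeta> \<notin> ?A \<union> ?S \<union> ?E" for \<zeta>
  proof -
    have "(\<Sum>v\<in>UNIV. \<Sum>w\<in>UNIV. arr v w * of_bool (\<zeta> = \<eta>(v := \<eta> v @ [w]))) = 0"
      using that by (intro sum.neutral ballI) auto
    moreover have "(\<Sum>v | \<eta> v \<noteq> []. pmf (service_pmf v \<eta>) \<zeta>) = 0"
      using that by (intro sum.neutral ballI) (auto simp: set_pmf_iff)
    moreover have "{e \<in> torus_edges. \<exists>v w. e = {v, w} \<and> v \<noteq> w \<and> \<zeta> = \<eta> \<circ> Transposition.transpose v w} = {}"
      using that by blast
    ultimately show ?thesis
      by (simp only: network_rate_def card.empty of_nat_0)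
  qed
  then have "{\<zeta>. network_rate arr \<beta> \<eta> \<zeta> \<noteq> 0} \<subseteq> ?A \<union> ?S \<union> ?E"
    by blast
  then show ?thesis
    using fin by (rule finite_subset)
qed

end

theory Submission
  imports Defs
begin

text \<open>
  Write \<open>n = K L\<close>. Tag two queues, located at \<open>p \<noteq> k\<close>, and consider a customer at position \<open>i\<close> of the
  queue at \<open>k\<close>. Until this customer is served, the pair of locations performs the walk generated
  by the swaps, and it is sampled at the \<open>(i + 1)\<close>-st ring of the clock of the queue. As that walk
  is irreducible and symmetric, deep in the queue the probability that the customer is then routed to
  the other tagged queue is close to its mean \<open>m = (n - 5) / (n (n - 1))\<close> over all pairs; here 5 is
  the size of the ball of radius 1, from which customers leave the network. Let \<open>\<psi> (i + 1)\<close> be the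
  centered probability and correct the length of the queue at \<open>p\<close> by the sum of \<open>\<psi> (i + 1)\<close> over
  the first \<open>M\<close> customers of every other queue. The resolvent equation relating \<open>\<psi> i\<close> and
  \<open>\<psi> (i + 1)\<close> makes the drift of the corrected length telescope: while all queues are longer than
  \<open>M\<close>, it equals \<open>\<lambda> - 1 + (n - 1) m = \<lambda> - 5 / n > 0\<close> up to the small error \<open>\<psi> M\<close>.

  Hence, for small \<open>\<epsilon>\<close>, the sum \<open>f\<close> over \<open>p\<close> of \<open>exp (- \<epsilon> h\<^sub>p)\<close>, where \<open>h\<^sub>p\<close> is the corrected
  length, has negative generator wherever \<open>f\<close> is below some level \<open>c\<close>, and \<open>min f c\<close> is
  superharmonic. Arrivals lead from every state to the region \<open>f < c\<close>, where the inequality is strict,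
  so the expected number of visits to each state is finite.
\<close>

section \<open>A transience criterion\<close>

primrec chain_law :: "('s \<Rightarrow> 's pmf) \<Rightarrow> 's \<Rightarrow> nat \<Rightarrow> 's pmf" where
  "chain_law J x 0 = return_pmf x"
| "chain_law J x (Suc n) = bind_pmf (chain_law J x n) J"

lemma chain_law_add: "chain_law J x (m + n) = bind_pmf (chain_law J x m) (\<lambda>y. chain_law J y n)"
  by (induction n) (simp_all add: bind_return_pmf' bind_assoc_pmf)

text \<open>The kernel for coordinate \<open>Suc n\<close> looks only at coordinate
  \<open>n\<close>. Integrating out the last coordinate therefore replaces \<open>f\<close> by its
  one-step average, which is why the induction keeps \<open>f\<close> arbitrary. The prefix of
  length \<open>Suc n\<close> consists of the coordinates \<open>0\<close> to \<open>n\<close>; the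
  kernel at \<open>0\<close> is the point mass at \<open>x\<close>.\<close>

lemma nn_integral_jump_chain_prefix:
  fixes q :: "'s::countable \<Rightarrow> 's \<Rightarrow> real" and f :: "'s \<Rightarrow> ennreal"
  shows "(\<integral>\<^sup>+\<omega>. f (\<omega> n) \<partial>Ionescu_Tulcea.C (jump_kernel q x) (\<lambda>_. count_space UNIV) 0 (Suc n) (\<lambda>_. undefined))
    = (\<integral>\<^sup>+y. f y \<partial>measure_pmf (chain_law (jump_pmf q) x n))"
proof -
  interpret IT: Ionescu_Tulcea "jump_kernel q x" "\<lambda>_. count_space UNIV"
    by (rule jump_kernel_Ionescu_Tulcea)
  let ?M = "\<lambda>n. PiM {0..<n} (\<lambda>_::nat. count_space (UNIV :: 's set))"
  let ?C = "\<lambda>n. IT.C 0 n (\<lambda>_. undefined)"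
  have und: "(\<lambda>_. undefined) \<in> space (?M 0)"
    by (simp add: space_PiM)
  have meas[measurable]: "(\<lambda>\<omega>. g (\<omega> n)) \<in> borel_measurable (?M (Suc n))" for n and g :: "'s \<Rightarrow> ennreal"
  proof -
    have "(\<lambda>\<omega>. \<omega> n) \<in> measurable (?M (Suc n)) (count_space UNIV)"
      by (rule measurable_component_singleton) simp
    then show ?thesis
      by (rule measurable_compose) simp
  qed
  have step: "(\<integral>\<^sup>+\<omega>. f (\<omega> n) \<partial>?C (Suc n)) = (\<integral>\<^sup>+\<omega>. (\<integral>\<^sup>+y. f y \<partial>jump_kernel q x n \<omega>) \<partial>?C n)"
    for n and f :: "'s \<Rightarrow> ennreal"
  proof -
    have "(\<integral>\<^sup>+\<omega>. f (\<omega> n) \<partial>?C (Suc n)) = (\<integral>\<^sup>+\<omega>. (\<integral>\<^sup>+\<omega>'. f (\<omega>' n) \<partial>IT.eP n \<omega>) \<partial>?C n)"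
      unfolding IT.C.simps add_0
      by (rule nn_integral_bind[where B = "?M (Suc n)"])
        (auto simp: IT.measurable_eP measurable_cong_sets[OF IT.sets_C[OF und] refl])
    also have "\<dots> = (\<integral>\<^sup>+\<omega>. (\<integral>\<^sup>+y. f y \<partial>jump_kernel q x n \<omega>) \<partial>?C n)"
      by (intro nn_integral_cong) (simp add: IT.space_C[OF und] IT.nn_integral_eP)
    finally show ?thesis .
  qed
  show ?thesis
  proof (induction n arbitrary: f)
    case 0
    show ?case
      unfolding step[where n = 0]
      by (subst IT.C.simps, subst nn_integral_return)
        (auto simp: jump_kernel_def space_PiM nn_integral_return_pmf)
  next
    case (Suc n)
    have "(\<integral>\<^sup>+\<omega>. f (\<omega> (Suc n)) \<partial>?C (Suc (Suc n)))
        = (\<integral>\<^sup>+\<omega>. (\<integral>\<^sup>+y. f y \<partial>measure_pmf (jump_pmf q (\<omega> n))) \<partial>?C (Suc n))"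
      unfolding step[where n = "Suc n"] by (simp add: jump_kernel_def)
    also have "\<dots> = (\<integral>\<^sup>+z. (\<integral>\<^sup>+y. f y \<partial>measure_pmf (jump_pmf q z)) \<partial>measure_pmf (chain_law (jump_pmf q) x n))"
      by (rule Suc)
    also have "\<dots> = (\<integral>\<^sup>+y. f y \<partial>measure_pmf (chain_law (jump_pmf q) x (Suc n)))"
      by simp
    finally show ?case .
  qed
qed

lemma sets_jump_chain: "sets (jump_chain q x) = sets (PiM UNIV (\<lambda>_. count_space UNIV))"
proof -
  interpret IT: Ionescu_Tulcea "jump_kernel q x" "\<lambda>_. count_space UNIV"
    by (rule jump_kernel_Ionescu_Tulcea)
  show ?thesis
    by (simp add: jump_chain_def)
qed

lemma space_jump_chain: "space (jump_chain q x) = UNIV"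
  using sets_eq_imp_space_eq[OF sets_jump_chain[of q x]] by (simp add: space_PiM)

lemma measurable_jump_chain_component:
  "(\<lambda>\<omega>. \<omega> n) \<in> measurable (jump_chain q x) (count_space UNIV)"
  unfolding measurable_cong_sets[OF sets_jump_chain refl]
  by (rule measurable_component_singleton) simp

text \<open>The event is a cylinder over the coordinates below \<open>Suc n\<close>, so the
  projective limit evaluates it through the finite-dimensional law.\<close>

lemma emeasure_jump_chain_component:
  "emeasure (jump_chain q x) {\<omega>. \<omega> n \<in> A} = emeasure (measure_pmf (chain_law (jump_pmf q) x n)) A"
proof -
  interpret IT: Ionescu_Tulcea "jump_kernel q x" "\<lambda>_. count_space UNIV"
    by (rule jump_kernel_Ionescu_Tulcea)
  let ?M = "PiM {0..<Suc n} (\<lambda>_::nat. count_space UNIV)"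
  let ?X = "{\<omega> \<in> space ?M. \<omega> n \<in> A}"
  have und: "(\<lambda>_. undefined) \<in> space (PiM {0..<0} (\<lambda>_::nat. count_space UNIV))"
    by (simp add: space_PiM)
  have X: "?X \<in> sets ?M"
  proof -
    have "(\<lambda>\<omega>. \<omega> n) \<in> measurable ?M (count_space UNIV)"
      by (rule measurable_component_singleton) simp
    then have "(\<lambda>\<omega>. \<omega> n) -` A \<inter> space ?M \<in> sets ?M"
      by (rule measurable_sets) simp
    also have "(\<lambda>\<omega>. \<omega> n) -` A \<inter> space ?M = ?X"
      by auto
    finally show ?thesis .
  qed
  have "{\<omega>. \<omega> n \<in> A} = IT.PF.emb UNIV {0..<Suc n} ?X"
    by (auto simp: prod_emb_def space_PiM)
  then have "emeasure (jump_chain q x) {\<omega>. \<omega> n \<in> A} = emeasure (IT.CI {0..<Suc n}) ?X"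
    unfolding jump_chain_def using IT.lim[OF _ X] by simp
  also have "\<dots> = emeasure (IT.C 0 (Suc n) (\<lambda>_. undefined)) ?X"
    by (subst IT.emeasure_CI[OF order_refl X], subst prod_emb_id)
      (use sets.sets_into_space[OF X] in \<open>auto simp: space_PiM\<close>)
  also have "\<dots> = (\<integral>\<^sup>+\<omega>. indicator ?X \<omega> \<partial>IT.C 0 (Suc n) (\<lambda>_. undefined))"
    by (subst nn_integral_indicator) (simp_all add: IT.sets_C[OF und] X del: IT.C.simps)
  also have "\<dots> = (\<integral>\<^sup>+\<omega>. indicator A (\<omega> n) \<partial>IT.C 0 (Suc n) (\<lambda>_. undefined))"
    by (intro nn_integral_cong) (auto simp: IT.space_C[OF und] indicator_def simp del: IT.C.simps)
  also have "\<dots> = emeasure (measure_pmf (chain_law (jump_pmf q) x n)) A"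
    by (subst nn_integral_jump_chain_prefix) simp
  finally show ?thesis .
qed

lemma prob_space_jump_chain: "prob_space (jump_chain q x)"
proof
  show "emeasure (jump_chain q x) (space (jump_chain q x)) = 1"
    using emeasure_jump_chain_component[of q x 0 UNIV] by (simp add: space_jump_chain)
qed

text \<open>First Borel-Cantelli lemma for the events that the chain is at \<open>y\<close> at step
  \<open>n\<close>.\<close>

lemma AE_jump_chain_finite_visits:
  assumes "summable (\<lambda>n. pmf (chain_law (jump_pmf q) x n) y)"
  shows "AE \<omega> in jump_chain q x. finite {n. \<omega> n = y}"
proof -
  interpret prob_space "jump_chain q x"
    by (rule prob_space_jump_chain)
  let ?A = "\<lambda>n. {\<omega>. \<omega> n \<in> {y}}"
  have A: "?A n \<in> sets (jump_chain q x)" for n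
    using measurable_sets[OF measurable_jump_chain_component, of "{y}" n q x]
    by (simp add: space_jump_chain vimage_def)
  have "measure (jump_chain q x) (?A n) = pmf (chain_law (jump_pmf q) x n) y" for n
    unfolding measure_def emeasure_jump_chain_component
    by (simp add: emeasure_pmf_single)
  with assms have "AE \<omega> in jump_chain q x. eventually (\<lambda>n. \<omega> \<in> space (jump_chain q x) - ?A n) sequentially"
    by (intro borel_cantelli_AE1 A) (simp_all add: emeasure_eq_measure)
  then show ?thesis
    by eventually_elim (auto simp: space_jump_chain cofinite_eq_sequentially[symmetric] eventually_cofinite)
qed

section \<open>From finitely many visits of the jump chain to bounded visit times\<close>

lemma jump_time_mono: "m \<le> n \<Longrightarrow> jump_time q \<omega> m \<le> jump_time q \<omega> n"
  by (cases \<omega>) (auto intro!: sum_mono2)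

text \<open>Positive exit rates make every jump time finite, and a jump time after the last visit
  bounds all visit times. From an explosion time on \<open>ctmc_at\<close> is \<open>None\<close>,
  so explosion adds no visits.\<close>

lemma bdd_above_visit_times:
  assumes pos: "\<And>y. exit_rate q y > 0" and fin: "finite {n. fst \<omega> n = x}"
  shows "bdd_above {t. 0 \<le> t \<and> ctmc_at q \<omega> t = Some x}"
proof -
  obtain Y T where \<omega>: "\<omega> = (Y, T)"
    by (cases \<omega>)
  obtain N where N: "\<And>n. Y n = x \<Longrightarrow> n < N"
    using fin finite_nat_set_iff_bounded[of "{n. Y n = x}"] by (auto simp: \<omega>)
  have less_top: "jump_time q \<omega> n < \<infinity>" for n
    using pos by (auto simp: \<omega> ennreal_divide_eq_top_iff ennreal_eq_0_iff less_top[symmetric] not_le)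
  have "t \<le> enn2real (jump_time q \<omega> N)" if t: "0 \<le> t" "ctmc_at q \<omega> t = Some x" for t
  proof -
    let ?P = "\<lambda>n. jump_time q \<omega> n \<le> ennreal t \<and> ennreal t < jump_time q \<omega> (Suc n)"
    have ex: "\<exists>n. ?P n" and x: "fst \<omega> (THE n. ?P n) = x"
      using t by (auto simp: ctmc_at_def split: if_splits)
    then obtain n where n: "?P n" by blast
    \<comment> \<open>The intervals between consecutive jump times are disjoint, so the
      \<open>THE\<close> in \<open>ctmc_at\<close> picks \<open>n\<close>.\<close>
    have "m = n" if "?P m" for m
    proof (rule ccontr)
      assume "m \<noteq> n"
      then consider "Suc m \<le> n" | "Suc n \<le> m" by linarith
      then show False
      proof cases
        case 1
        with \<open>?P m\<close> n jump_time_mono[OF 1, of q \<omega>] show False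
          by (meson leD order_trans)
      next
        case 2
        with \<open>?P m\<close> n jump_time_mono[OF 2, of q \<omega>] show False
          by (meson leD order_trans)
      qed
    qed
    with n have "(THE n. ?P n) = n" by (rule the_equality)
    with x have "fst \<omega> n = x" by (simp only:)
    then have "n < N" by (intro N) (simp add: \<omega>)
    then have "ennreal t \<le> jump_time q \<omega> N"
      using n jump_time_mono[of "Suc n" N q \<omega>] by (meson Suc_leI less_imp_le order_trans)
    then show ?thesis
      using enn2real_mono[of "ennreal t" "jump_time q \<omega> N"] less_top[of N] t(1)
      by (simp add: infinity_ennreal_def)
  qed
  then show ?thesis
    by (intro bdd_aboveI) auto
qed

text \<open>Finiteness of the number of visits concerns the first factor of \<open>ctmc\<close>
  only: its null set times the space of all holding times is a null set of the product.\<close>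

lemma transient_stateI:
  assumes pos: "\<And>y. exit_rate q y > 0"
    and "summable (\<lambda>n. pmf (chain_law (jump_pmf q) x n) x)"
  shows "transient_state q x"
proof -
  let ?T = "PiM UNIV (\<lambda>_::nat. density lborel (\<lambda>t. ennreal (exponential_density 1 t)))"
  interpret T: prob_space ?T
    by (intro prob_space_PiM prob_space_exponential_density) simp
  have "AE \<omega> in jump_chain q x. finite {n. \<omega> n = x}"
    using assms by (intro AE_jump_chain_finite_visits)
  then obtain N where N: "{\<omega> \<in> space (jump_chain q x). \<not> finite {n. \<omega> n = x}} \<subseteq> N"
      "emeasure (jump_chain q x) N = 0" "N \<in> sets (jump_chain q x)"
    by (rule AE_E)
  have "AE \<omega> in ctmc q x. finite {n. fst \<omega> n = x}"
  proof (rule AE_I)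
    show "{\<omega> \<in> space (ctmc q x). \<not> finite {n. fst \<omega> n = x}} \<subseteq> N \<times> space ?T"
      using N(1) by (auto simp: ctmc_def space_pair_measure)
    show "N \<times> space ?T \<in> sets (ctmc q x)"
      unfolding ctmc_def using N(3) by (intro pair_measureI) auto
    show "emeasure (ctmc q x) (N \<times> space ?T) = 0"
      unfolding ctmc_def by (subst T.emeasure_pair_measure_Times) (use N in auto)
  qed
  then show ?thesis
    unfolding transient_state_def by eventually_elim (rule bdd_above_visit_times[OF pos])
qed


section \<open>Superharmonic functions and expected numbers of visits\<close>

lemma finite_set_pmf_chain_law:
  "(\<And>y. finite (set_pmf (J y))) \<Longrightarrow> finite (set_pmf (chain_law J x n))"
  by (induction n) simp_all

lemma expectation_bind_pmf_finite:
  fixes h :: "'b \<Rightarrow> real"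
  assumes "finite (set_pmf p)" and "\<And>x. finite (set_pmf (f x))"
  shows "measure_pmf.expectation (bind_pmf p f) h
    = measure_pmf.expectation p (\<lambda>x. measure_pmf.expectation (f x) h)"
  using assms by (simp add: pmf_expectation_bind[OF assms(1) _ order_refl] integral_measure_pmf[OF assms(1)])

lemma superharmonic_chain_law:
  fixes g :: "'s \<Rightarrow> real"
  assumes fin: "\<And>y. finite (set_pmf (J y))"
    and super: "\<And>y. measure_pmf.expectation (J y) g \<le> g y"
  shows "measure_pmf.expectation (chain_law J x n) g \<le> g x"
proof (induction n)
  case (Suc n)
  have "measure_pmf.expectation (chain_law J x (Suc n)) g
      = measure_pmf.expectation (chain_law J x n) (\<lambda>y. measure_pmf.expectation (J y) g)"
    using fin by (simp add: expectation_bind_pmf_finite finite_set_pmf_chain_law)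
  also have "\<dots> \<le> measure_pmf.expectation (chain_law J x n) g"
    by (intro integral_mono integrable_measure_pmf_finite finite_set_pmf_chain_law fin super)
  finally show ?case
    using Suc by linarith
qed simp

text \<open>
  If \<open>P\<close> is the transition operator and \<open>u = g - P\<^sup>m g\<close>, then \<open>u \<ge> 0\<close>, \<open>u x > 0\<close>, and the
  sums \<open>\<Sum>n<N. P\<^sup>n u\<close> telescope; they bound the expected number of visits to \<open>x\<close>.
\<close>

lemma summable_pmf_chain_law:
  fixes g :: "'s \<Rightarrow> real"
  assumes fin: "\<And>y. finite (set_pmf (J y))"
    and nonneg: "\<And>y. 0 \<le> g y"
    and super: "\<And>y. measure_pmf.expectation (J y) g \<le> g y"
    and strict: "measure_pmf.expectation (chain_law J x m) g < g x"
  shows "summable (\<lambda>n. pmf (chain_law J x n) x)"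
proof -
  let ?E = "\<lambda>y n. measure_pmf.expectation (chain_law J y n)"
  define u where "u y = g y - ?E y m g" for y
  have u_nonneg: "u y \<ge> 0" for y
    using superharmonic_chain_law[OF fin super, of y m] by (simp add: u_def)
  have u_pos: "u x > 0"
    using strict by (simp add: u_def)
  note int = integrable_measure_pmf_finite[OF finite_set_pmf_chain_law[OF fin]]
  define a where "a n = ?E x n g" for n
  have a_nonneg: "a n \<ge> 0" for n
    unfolding a_def by (intro integral_nonneg_AE AE_I2 nonneg)
  have Eu: "?E x n u = a n - a (n + m)" for n
  proof -
    have "?E x n u = ?E x n g - ?E x n (\<lambda>y. ?E y m g)"
      unfolding u_def by (intro Bochner_Integration.integral_diff int)
    also have "?E x n (\<lambda>y. ?E y m g) = ?E x (n + m) g"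
      unfolding chain_law_add by (intro expectation_bind_pmf_finite[symmetric] finite_set_pmf_chain_law fin)
    finally show ?thesis
      by (simp add: a_def)
  qed
  have le: "u x * pmf (chain_law J x n) x \<le> a n - a (n + m)" for n
  proof -
    have "u x * pmf (chain_law J x n) x = ?E x n (\<lambda>y. indicat_real {x} y * u x)"
      by (simp add: measure_pmf_single)
    also have "\<dots> \<le> ?E x n u"
      by (intro integral_mono int) (auto simp: indicator_def u_nonneg)
    finally show ?thesis
      by (simp add: Eu)
  qed
  have split: "(\<Sum>n<M + N. a n) = (\<Sum>n<M. a n) + (\<Sum>n<N. a (n + M))" for M N :: nat
    by (induction N) (simp_all add: add.commute)
  have "(\<Sum>n<N. pmf (chain_law J x n) x) \<le> (\<Sum>n<m. a n) / u x" for N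
  proof -
    have "u x * (\<Sum>n<N. pmf (chain_law J x n) x) \<le> (\<Sum>n<N. a n - a (n + m))"
      unfolding sum_distrib_left by (intro sum_mono le)
    also have "\<dots> = (\<Sum>n<N. a n) - (\<Sum>n<N. a (n + m))"
      by (rule sum_subtractf)
    \<comment> \<open>Splitting the sum of the first \<open>m + N\<close> terms in both possible
      ways trades the shift by \<open>m\<close> for a shift by \<open>N\<close>.\<close>
    also have "\<dots> = (\<Sum>n<m. a n) - (\<Sum>n<m. a (n + N))"
      using split[of N m] split[of m N] by (simp add: add.commute)
    also have "\<dots> \<le> (\<Sum>n<m. a n)"
      using a_nonneg by (simp add: sum_nonneg)
    finally show ?thesis
      using u_pos by (simp add: pos_le_divide_eq mult.commute)
  qed
  then show ?thesis
    by (intro summableI_nonneg_bounded) auto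
qed

text \<open>The number \<open>m\<close> of steps may depend on the state. This matters where
  \<open>g\<close> is locally constant: the chain only has to reach, with positive probability, a
  region where \<open>g\<close> is smaller.\<close>

lemma transient_ctmcI:
  fixes g :: "'s::countable \<Rightarrow> real"
  assumes "\<And>y. exit_rate q y > 0"
    and "\<And>y. finite (set_pmf (jump_pmf q y))"
    and "\<And>y. 0 \<le> g y"
    and "\<And>y. measure_pmf.expectation (jump_pmf q y) g \<le> g y"
    and "\<And>y. \<exists>m. measure_pmf.expectation (chain_law (jump_pmf q) y m) g < g y"
  shows "transient_ctmc q"
  unfolding transient_ctmc_def
proof
  fix x
  obtain m where "measure_pmf.expectation (chain_law (jump_pmf q) x m) g < g x"
    using assms(5) by blast
  with assms show "transient_state q x"
    by (intro transient_stateI summable_pmf_chain_law)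
qed

section \<open>Resolvents of involution walks\<close>

text \<open>Dirichlet form of the symmetric walk that jumps along \<open>T\<close>. Expand the
  square; as \<open>T\<close> is a bijection, \<open>f\<close> and its composition with
  \<open>T\<close> have the same sum of squares.\<close>

lemma sum_involution_square_diff:
  fixes f :: "'x::finite \<Rightarrow> real"
  assumes inv: "\<And>x. T (T x) = x"
  shows "2 * (\<Sum>x\<in>UNIV. f x * (f x - f (T x))) = (\<Sum>x\<in>UNIV. (f x - f (T x))\<^sup>2)"
proof -
  have eq: "(\<Sum>x\<in>UNIV. g (T x)) = (\<Sum>x\<in>UNIV. g x)" for g :: "'x \<Rightarrow> real"
    by (rule sum.reindex_bij_witness[where i = T and j = T]) (auto simp: inv)
  have "(\<Sum>x\<in>UNIV. (f x - f (T x))\<^sup>2)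
      = (\<Sum>x\<in>UNIV. f x * f x) + (\<Sum>x\<in>UNIV. f (T x) * f (T x)) - 2 * (\<Sum>x\<in>UNIV. f x * f (T x))"
    by (simp add: power2_eq_square algebra_simps sum.distrib sum_subtractf sum_distrib_left)
  then show ?thesis
    by (simp add: eq[of "\<lambda>x. f x * f x"] right_diff_distrib sum_subtractf)
qed

lemma sum_involutions_square_diff:
  fixes f :: "'x::finite \<Rightarrow> real" and T :: "'e \<Rightarrow> 'x \<Rightarrow> 'x"
  assumes inv: "\<And>e x. T e (T e x) = x"
  shows "2 * (\<Sum>x\<in>UNIV. f x * (\<Sum>e\<in>E. f x - f (T e x))) = (\<Sum>e\<in>E. \<Sum>x\<in>UNIV. (f x - f (T e x))\<^sup>2)"
  unfolding sum_distrib_left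
  by (subst sum.swap) (simp add: sum_involution_square_diff[of "T _", OF inv, symmetric] sum_distrib_left)

text \<open>By the Dirichlet form identity the quadratic form of \<open>A\<close> is at least the
  squared norm. Hence \<open>A\<close> is injective, and surjective because the dimension is finite.
  Probabilistically, \<open>g x\<close> is the mean of \<open>f\<close> at an independent
  exponential time of rate 1 for the walk from \<open>x\<close> that applies each \<open>T e\<close>
  at rate \<beta>.\<close>

lemma resolvent_exists:
  fixes f :: "'x::finite \<Rightarrow> real" and T :: "'e \<Rightarrow> 'x \<Rightarrow> 'x"
  assumes inv: "\<And>e x. T e (T e x) = x" and "\<beta> \<ge> 0"
  shows "\<exists>g. \<forall>x. f x = g x + \<beta> * (\<Sum>e\<in>E. g x - g (T e x))"
proof -
  define A :: "real ^ 'x \<Rightarrow> real ^ 'x" where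
    "A v = (\<chi> x. v $ x + \<beta> * (\<Sum>e\<in>E. v $ x - v $ T e x))" for v
  have lin: "linear A"
    by (rule linearI)
      (simp_all add: A_def vec_eq_iff algebra_simps sum.distrib sum_subtractf sum_distrib_left)
  have "v = 0" if "A v = 0" for v
  proof -
    have "0 = 2 * (\<Sum>x\<in>UNIV. v $ x * A v $ x)"
      using that by simp
    also have "\<dots> = 2 * (\<Sum>x\<in>UNIV. (v $ x)\<^sup>2) + \<beta> * (2 * (\<Sum>x\<in>UNIV. v $ x * (\<Sum>e\<in>E. v $ x - v $ T e x)))"
      by (simp add: A_def algebra_simps sum.distrib sum_distrib_left power2_eq_square)
    also have "2 * (\<Sum>x\<in>UNIV. v $ x * (\<Sum>e\<in>E. v $ x - v $ T e x))
        = (\<Sum>e\<in>E. \<Sum>x\<in>UNIV. (v $ x - v $ T e x)\<^sup>2)"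
      by (rule sum_involutions_square_diff[OF inv])
    also have "2 * (\<Sum>x\<in>UNIV. (v $ x)\<^sup>2) + \<beta> * \<dots> \<ge> 2 * (\<Sum>x\<in>UNIV. (v $ x)\<^sup>2)"
      using \<open>\<beta> \<ge> 0\<close> by (simp add: sum_nonneg)
    finally have "(\<Sum>x\<in>UNIV. (v $ x)\<^sup>2) \<le> 0"
      by linarith
    then have "(\<Sum>x\<in>UNIV. (v $ x)\<^sup>2) = 0"
      by (intro antisym) (simp_all add: sum_nonneg)
    then show ?thesis
      by (simp add: sum_nonneg_eq_0_iff vec_eq_iff)
  qed
  then have "inj A"
    by (simp add: linear_injective_0[OF lin])
  then have "surj A"
    by (rule linear_injective_imp_surjective[OF lin _ refl])
  from surjD[OF this, of "\<chi> x. f x"] obtain v where v: "(\<chi> x. f x) = A v"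
    by blast
  have "f x = v $ x + \<beta> * (\<Sum>e\<in>E. v $ x - v $ T e x)" for x
    using arg_cong[OF v, of "\<lambda>w. w $ x"] by (simp add: A_def)
  then show ?thesis
    by (intro exI[of _ "\<lambda>x. v $ x"]) blast
qed

text \<open>
  Each step lowers the sum of the squares by at least \<open>\<beta>\<close> times the Dirichlet form, so the Dirichlet
  forms are summable; no spectral gap is needed.
\<close>

lemma iterated_resolvent_gradient_tendsto_0:
  fixes h :: "nat \<Rightarrow> 'x::finite \<Rightarrow> real" and T :: "'e \<Rightarrow> 'x \<Rightarrow> 'x"
  assumes inv: "\<And>e x. T e (T e x) = x" and "\<beta> > 0" and "finite E"
    and h: "\<And>i x. h i x = h (Suc i) x + \<beta> * (\<Sum>e\<in>E. h (Suc i) x - h (Suc i) (T e x))"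
    and "e \<in> E"
  shows "(\<lambda>i. h i x - h i (T e x)) \<longlonglongrightarrow> 0"
proof -
  define S where "S i = (\<Sum>x\<in>UNIV. (h i x)\<^sup>2)" for i
  define D where "D i = (\<Sum>e\<in>E. \<Sum>x\<in>UNIV. (h i x - h i (T e x))\<^sup>2)" for i
  have D_nonneg: "D i \<ge> 0" for i
    by (simp add: D_def sum_nonneg)
  have step: "\<beta> * D (Suc i) \<le> S i - S (Suc i)" for i
  proof -
    let ?a = "h (Suc i)" and ?b = "\<lambda>x. \<Sum>e\<in>E. h (Suc i) x - h (Suc i) (T e x)"
    have D2: "2 * (\<Sum>x\<in>UNIV. ?a x * ?b x) = D (Suc i)"
      unfolding D_def by (rule sum_involutions_square_diff[OF inv])
    have "\<beta> * D (Suc i) = 2 * \<beta> * (\<Sum>x\<in>UNIV. ?a x * ?b x)"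
      unfolding D2[symmetric] by (simp only: mult_ac)
    also have "\<dots> = (\<Sum>x\<in>UNIV. 2 * \<beta> * (?a x * ?b x))"
      by (rule sum_distrib_left)
    also have "\<dots> \<le> (\<Sum>x\<in>UNIV. (h i x)\<^sup>2 - (?a x)\<^sup>2)"
    proof (rule sum_mono)
      fix x
      have "(h i x)\<^sup>2 = (?a x)\<^sup>2 + 2 * \<beta> * (?a x * ?b x) + (\<beta> * ?b x)\<^sup>2"
        unfolding h[of i x] by (simp add: power2_eq_square algebra_simps)
      then show "2 * \<beta> * (?a x * ?b x) \<le> (h i x)\<^sup>2 - (?a x)\<^sup>2"
        using zero_le_power2[of "\<beta> * ?b x"] by linarith
    qed
    finally show ?thesis
      by (simp add: S_def sum_subtractf)
  qed
  have "(\<Sum>i<N. D (Suc i)) \<le> S 0 / \<beta>" for N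
  proof -
    have "\<beta> * (\<Sum>i<N. D (Suc i)) \<le> (\<Sum>i<N. S i - S (Suc i))"
      unfolding sum_distrib_left by (intro sum_mono step)
    also have "\<dots> \<le> S 0"
      unfolding sum_lessThan_telescope' by (simp add: S_def sum_nonneg)
    finally show ?thesis
      using \<open>\<beta> > 0\<close> by (simp add: field_simps)
  qed
  then have "summable (\<lambda>i. D (Suc i))"
    by (intro summableI_nonneg_bounded) (auto intro: D_nonneg)
  then have "D \<longlonglongrightarrow> 0"
    by (intro summable_LIMSEQ_zero) (simp add: summable_Suc_iff)
  then have lim: "(\<lambda>i. sqrt (D i)) \<longlonglongrightarrow> 0"
    using tendsto_real_sqrt[of D 0 sequentially] by (simp only: real_sqrt_zero)
  have "norm (h i x - h i (T e x)) \<le> sqrt (D i)" for i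
  proof (rule real_le_rsqrt)
    have "(h i x - h i (T e x))\<^sup>2 \<le> (\<Sum>x\<in>UNIV. (h i x - h i (T e x))\<^sup>2)"
      by (intro member_le_sum) auto
    also have "\<dots> \<le> D i"
      unfolding D_def using \<open>finite E\<close> \<open>e \<in> E\<close>
      by (intro member_le_sum[where f = "\<lambda>e. \<Sum>x\<in>UNIV. (h i x - h i (T e x))\<^sup>2"]) (auto intro: sum_nonneg)
    finally show "(norm (h i x - h i (T e x)))\<^sup>2 \<le> D i"
      by simp
  qed
  then show ?thesis
    by (intro Lim_null_comparison[OF always_eventually[OF allI] lim])
qed

text \<open>Every \<open>T e\<close> permutes \<open>A\<close>, so the differences sum to zero over
  \<open>A\<close> and the resolvent preserves the total.\<close>

lemma iterated_resolvent_sum: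
  fixes h :: "nat \<Rightarrow> 'x::finite \<Rightarrow> real" and T :: "'e \<Rightarrow> 'x \<Rightarrow> 'x"
  assumes inv: "\<And>e x. T e (T e x) = x" and A: "\<And>e x. x \<in> A \<Longrightarrow> T e x \<in> A"
    and h: "\<And>i x. h i x = h (Suc i) x + \<beta> * (\<Sum>e\<in>E. h (Suc i) x - h (Suc i) (T e x))"
  shows "(\<Sum>x\<in>A. h i x) = (\<Sum>x\<in>A. h 0 x)"
proof (induction i)
  case (Suc i)
  have "(\<Sum>x\<in>A. g (T e x)) = (\<Sum>x\<in>A. g x)" for g :: "'x \<Rightarrow> real" and e
    by (rule sum.reindex_bij_witness[where i = "T e" and j = "T e"]) (auto simp: inv A)
  then have "(\<Sum>x\<in>A. \<Sum>e\<in>E. h (Suc i) x - h (Suc i) (T e x)) = 0"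
    by (subst sum.swap) (simp add: sum_subtractf)
  then have "(\<Sum>x\<in>A. h i x) = (\<Sum>x\<in>A. h (Suc i) x)"
    by (subst h) (simp add: sum.distrib sum_distrib_left[symmetric])
  with Suc show ?case by simp
qed simp


section \<open>Pairs of particles under edge swaps\<close>

text \<open>
  For a set \<open>e\<close> that is not of the form \<open>{v, w}\<close> this is some arbitrary transposition, so that
  \<open>edge_swap e\<close> is an involution without side conditions.
\<close>

definition edge_swap :: "'v set \<Rightarrow> 'v \<Rightarrow> 'v" where
  "edge_swap e = (SOME t. \<exists>v w. (e = {v, w} \<or> (\<nexists>a b. e = {a, b})) \<and> t = Transposition.transpose v w)"

lemma edge_swap_eq: "edge_swap {v, w} = Transposition.transpose v w"
proof -
  have "\<exists>t a b. ({v, w} = {a, b} \<or> (\<nexists>a b. {v, w} = {a, b})) \<and> t = Transposition.transpose a b"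
    by blast
  then have "\<exists>a b. ({v, w} = {a, b} \<or> (\<nexists>a b. {v, w} = {a, b})) \<and> edge_swap {v, w} = Transposition.transpose a b"
    unfolding edge_swap_def by (rule someI_ex)
  then show ?thesis
    by (metis doubleton_eq_iff transpose_commute)
qed

lemma edge_swap_involutory [simp]: "edge_swap e (edge_swap e x) = x"
proof -
  have "\<exists>t a b. (e = {a, b} \<or> (\<nexists>a b. e = {a, b})) \<and> t = Transposition.transpose a b"
    by blast
  then have "\<exists>a b. (e = {a, b} \<or> (\<nexists>a b. e = {a, b})) \<and> edge_swap e = Transposition.transpose a b"
    unfolding edge_swap_def by (rule someI_ex)
  then show ?thesis
    by auto
qed

lemma edge_swap_eq_iff [simp]: "edge_swap e x = edge_swap e y \<longleftrightarrow> x = y"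
  by (metis edge_swap_involutory)

text \<open>The transpositions along the edges of a connected graph generate all others: following a
  path from \<open>a\<close>, the swap of \<open>a\<close> and \<open>c\<close> is the swap of
  \<open>a\<close> and \<open>b\<close> conjugating the swap of \<open>b\<close> and
  \<open>c\<close>.\<close>

lemma transposition_induct_connected:
  fixes G :: "'v set set"
  assumes conn: "(a, c) \<in> {(x, y). {x, y} \<in> G}\<^sup>*"
    and edge: "\<And>x y. {x, y} \<in> G \<Longrightarrow> P (Transposition.transpose x y)"
    and id: "P id" and comp: "\<And>s t. P s \<Longrightarrow> P t \<Longrightarrow> P (s \<circ> t)"
  shows "P (Transposition.transpose a c)"
  using conn
proof (induction rule: rtrancl_induct)
  case base
  show ?case using id by (simp add: id_def)
next
  case (step b c)
  then have ab: "P (Transposition.transpose a b)" and bc: "P (Transposition.transpose b c)"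
    using edge by auto
  consider "a = c" | "b = c" | "a \<noteq> c" "b \<noteq> c" by blast
  then show ?case
  proof cases
    case 1
    then show ?thesis using id by (simp add: id_def)
  next
    case 2
    then show ?thesis using ab by simp
  next
    case 3
    then show ?thesis
      using comp[OF comp[OF ab bc] ab] by (simp add: transpose_comp_triple)
  qed
qed

text \<open>The permutations along which the differences of \<open>h i\<close> vanish in the limit
  are closed under composition and contain the edge swaps, hence all transpositions. Two
  transpositions carry any pair of distinct nodes to any other, so \<open>h i\<close> becomes
  constant off the diagonal; its conserved total 0 forces the limit 0.\<close>

lemma iterated_pair_resolvent_tendsto_0:
  fixes h :: "nat \<Rightarrow> 'v::finite \<times> 'v \<Rightarrow> real" and G :: "'v set set"
  assumes conn: "\<And>a b. (a, b) \<in> {(x, y). {x, y} \<in> G}\<^sup>*" and "\<beta> > 0"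
    and h: "\<And>i x. h i x = h (Suc i) x
      + \<beta> * (\<Sum>e\<in>G. h (Suc i) x - h (Suc i) (map_prod (edge_swap e) (edge_swap e) x))"
    and sum0: "(\<Sum>x | fst x \<noteq> snd x. h 0 x) = 0"
    and x: "fst x \<noteq> snd x"
  shows "(\<lambda>i. h i x) \<longlonglongrightarrow> 0"
proof -
  define P where "P t \<longleftrightarrow> (\<forall>x. (\<lambda>i. h i x - h i (map_prod t t x)) \<longlonglongrightarrow> 0)" for t
  let ?A = "{x::'v \<times> 'v. fst x \<noteq> snd x}"
  have inv: "map_prod (edge_swap e) (edge_swap e) (map_prod (edge_swap e) (edge_swap e) x) = x"
    for e and x :: "'v \<times> 'v"
    by (cases x) simp
  have swap: "P (Transposition.transpose a b)" for a b
  proof (rule transposition_induct_connected[OF conn])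
    fix x y assume "{x, y} \<in> G"
    then show "P (Transposition.transpose x y)"
      using iterated_resolvent_gradient_tendsto_0[where T = "\<lambda>e. map_prod (edge_swap e) (edge_swap e)" and
          h = h and E = G and e = "{x, y}", OF inv \<open>\<beta> > 0\<close> _ h]
      by (simp add: P_def edge_swap_eq)
  next
    show "P id"
      by (simp add: P_def map_prod.id)
  next
    fix s t assume st: "P s" "P t"
    show "P (s \<circ> t)"
      unfolding P_def
    proof
      fix x
      have "(\<lambda>i. h i x - h i (map_prod t t x) + (h i (map_prod t t x) - h i (map_prod s s (map_prod t t x))))
          \<longlonglongrightarrow> 0 + 0"
        by (rule tendsto_add[OF st(2)[unfolded P_def, rule_format] st(1)[unfolded P_def, rule_format]])
      then show "(\<lambda>i. h i x - h i (map_prod (s \<circ> t) (s \<circ> t) x)) \<longlonglongrightarrow> 0"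
        by (cases x) simp
    qed
  qed
  have diff: "(\<lambda>i. h i x - h i y) \<longlonglongrightarrow> 0" if xy: "x \<in> ?A" "y \<in> ?A" for x y
  proof -
    obtain p k p' k' where [simp]: "x = (p, k)" "y = (p', k')"
      by (cases x, cases y)
    \<comment> \<open>First \<open>s\<close> brings the first particle to its place. Then
      \<open>t\<close> brings the second one to \<open>k'\<close> and leaves the first alone, as
      both \<open>s k\<close> and \<open>k'\<close> differ from \<open>p'\<close>.\<close>
    define s where "s = Transposition.transpose p p'"
    define t where "t = Transposition.transpose (s k) k'"
    have "s p = p'" by (simp add: s_def)
    have "p \<noteq> k" using xy by simp
    then have "s k \<noteq> s p" unfolding s_def by (metis transpose_eq_imp_eq)
    then have "s k \<noteq> p'" using \<open>s p = p'\<close> by simp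
    with xy have "t p' = p'" "t (s k) = k'" by (simp_all add: t_def)
    have "(\<lambda>i. h i (p, k) - h i (map_prod s s (p, k))
        + (h i (map_prod s s (p, k)) - h i (map_prod t t (map_prod s s (p, k))))) \<longlonglongrightarrow> 0 + 0"
      unfolding s_def t_def
      by (rule tendsto_add[OF swap[unfolded P_def, rule_format] swap[unfolded P_def, rule_format]])
    then show ?thesis
      using \<open>s p = p'\<close> \<open>t p' = p'\<close> \<open>t (s k) = k'\<close> by simp
  qed
  have x: "x \<in> ?A" using x by simp
  have total: "(\<Sum>y\<in>?A. h i y) = 0" for i
    using iterated_resolvent_sum[where T = "\<lambda>e. map_prod (edge_swap e) (edge_swap e)" and
          h = h and E = G and A = ?A, OF inv _ h] sum0 by simp
  \<comment> \<open>The total is zero, so a value is the average of its differences to all values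
    off the diagonal.\<close>
  have "h i x = (\<Sum>y\<in>?A. h i x - h i y) / card ?A" for i
    using x by (auto simp: sum_subtractf total card_gt_0_iff)
  moreover have "(\<lambda>i. (\<Sum>y\<in>?A. h i x - h i y) / card ?A) \<longlonglongrightarrow> (\<Sum>y\<in>?A. 0) / card ?A"
    using x by (intro tendsto_intros diff) (auto simp: card_gt_0_iff)
  ultimately show ?thesis by simp
qed

section \<open>The torus and the routing\<close>

lemma mod_ring_one_neq_neg_one:
  assumes "CARD('a::nontriv) \<ge> 3"
  shows "(1 :: 'a mod_ring) \<noteq> - 1"
  using assms by transfer auto

lemma mod_ring_of_nat: "\<exists>i. (x :: 'a::nontriv mod_ring) = of_nat i"
proof -
  have "to_int_mod_ring x \<ge> 0"
    using range_to_int_mod_ring[where ?'a = 'a] by auto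
  then have "x = of_nat (nat (to_int_mod_ring x))"
    by (simp add: of_nat_of_int_mod_ring)
  then show ?thesis ..
qed

lemma adj_sym: "adj v w \<longleftrightarrow> adj w v"
proof -
  have neg: "- x \<in> {(1, 0), (- 1, 0), (0, 1), (0, - 1)}" if "x \<in> {(1, 0), (- 1, 0), (0, 1), (0, - 1)}"
    for x :: "('k::nontriv, 'l::nontriv) torus"
    using that by auto
  have "adj w v" if "adj v w" for v w :: "('k::nontriv, 'l::nontriv) torus"
    using neg[of "w - v"] that unfolding adj_def minus_diff_eq .
  then show ?thesis by blast
qed

lemma adj_irrefl [simp]: "\<not> adj v v"
  by (auto simp: adj_def zero_prod_def)

lemma torus_edges_iff: "{v, w} \<in> torus_edges \<longleftrightarrow> adj v w"
  unfolding torus_edges_def mem_Collect_eq doubleton_eq_iff using adj_sym by blast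

lemma torus_connected: "(v, w) \<in> {(a, b). adj a b}\<^sup>*"
proof -
  have nat: "(v, v + (of_nat i, of_nat j)) \<in> {(a, b). adj a b}\<^sup>*" for i j
  proof (induction i)
    case 0
    show ?case
    proof (induction j)
      case 0
      then show ?case by (simp add: zero_prod_def[symmetric])
    next
      case (Suc j)
      have "adj (v + (of_nat 0, of_nat j)) (v + (of_nat 0, of_nat (Suc j)))"
        by (simp add: adj_def)
      with Suc show ?case
        by (meson case_prodI mem_Collect_eq rtrancl.rtrancl_into_rtrancl)
    qed
  next
    case (Suc i)
    have "adj (v + (of_nat i, of_nat j)) (v + (of_nat (Suc i), of_nat j))"
      by (simp add: adj_def)
    with Suc show ?case
      by (meson case_prodI mem_Collect_eq rtrancl.rtrancl_into_rtrancl)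
  qed
  obtain i j where "fst (w - v) = of_nat i" "snd (w - v) = of_nat j"
    using mod_ring_of_nat by metis
  then have "(of_nat i, of_nat j) = w - v"
    by (metis prod.collapse)
  moreover have "v + (w - v) = w" by simp
  ultimately show ?thesis
    using nat[of i j] by (simp only:)
qed

lemma torus_dist_relpow: "(v, w) \<in> {(a, b). adj a b} ^^ torus_dist v w"
  unfolding torus_dist_def by (rule LeastI_ex) (use torus_connected rtrancl_imp_relpow in blast)

lemma torus_dist_le: "(v, w) \<in> {(a, b). adj a b} ^^ n \<Longrightarrow> torus_dist v w \<le> n"
  unfolding torus_dist_def by (rule Least_le)

lemma torus_dist_le_1_iff: "torus_dist v w \<le> 1 \<longleftrightarrow> v = w \<or> adj v w"
proof
  assume "torus_dist v w \<le> 1"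
  then consider "torus_dist v w = 0" | "torus_dist v w = 1" by linarith
  then show "v = w \<or> adj v w"
    using torus_dist_relpow[of v w] by cases simp_all
next
  assume "v = w \<or> adj v w"
  then show "torus_dist v w \<le> 1"
  proof
    assume "v = w"
    then show ?thesis using torus_dist_le[of v w 0] by simp
  next
    assume "adj v w"
    then show ?thesis using torus_dist_le[of v w 1] by simp
  qed
qed

text \<open>The ball is a reflected translate of the five elements of \<open>?S\<close>. They are
  distinct because \<open>1\<close> and \<open>- 1\<close> differ in both factors, which needs side
  lengths of at least 3.\<close>

lemma card_torus_ball:
  fixes d :: "('k::nontriv, 'l::nontriv) torus"
  assumes "CARD('k) \<ge> 3" and "CARD('l) \<ge> 3"
  shows "card {v. torus_dist v d \<le> 1} = 5"
proof -
  have neq: "(1 :: 'k mod_ring) \<noteq> - 1" "(1 :: 'l mod_ring) \<noteq> - 1"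
    using assms by (simp_all add: mod_ring_one_neq_neg_one)
  let ?S = "{0, (1, 0), (- 1, 0), (0, 1), (0, - 1)} :: ('k, 'l) torus set"
  have "v = d \<or> adj v d \<longleftrightarrow> v \<in> (\<lambda>s. d - s) ` ?S" for v
  proof -
    have img: "v \<in> (\<lambda>s. d - s) ` S \<longleftrightarrow> d - v \<in> S" for S
      by (auto intro: image_eqI[of _ _ "d - v"])
    show ?thesis
      by (subst img) (simp add: adj_def eq_commute[of v d])
  qed
  then have "{v. torus_dist v d \<le> 1} = (\<lambda>s. d - s) ` ?S"
    unfolding torus_dist_le_1_iff by blast
  moreover have "card ((\<lambda>s. d - s) ` ?S) = card ?S"
    by (intro card_image inj_onI) simp
  moreover have "card ?S = 5"
    using neq neq[symmetric] by (simp add: zero_prod_def)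
  ultimately show ?thesis by simp
qed

definition next_nodes :: "('k::nontriv, 'l::nontriv) torus \<Rightarrow> ('k, 'l) torus \<Rightarrow> ('k, 'l) torus set" where
  "next_nodes v d = {w. adj v w \<and> torus_dist w d + 1 = torus_dist v d}"

text \<open>The second node of a shortest path from \<open>v\<close> to \<open>d\<close>
  qualifies.\<close>

lemma next_nodes_nonempty:
  assumes "\<not> torus_dist v d \<le> 1"
  shows "next_nodes v d \<noteq> {}"
proof -
  from assms obtain m where m: "torus_dist v d = Suc m"
    by (cases "torus_dist v d") auto
  with torus_dist_relpow[of v d] have "(v, d) \<in> {(a, b). adj a b} ^^ Suc m"
    by simp
  from relpow_Suc_D2[OF this] obtain w where "(v, w) \<in> {(a, b). adj a b}"
    and wd: "(w, d) \<in> {(a, b). adj a b} ^^ m"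
    by (elim exE conjE)
  then have vw: "adj v w" by simp
  have "(v, d) \<in> {(a, b). adj a b} ^^ Suc (torus_dist w d)"
    by (rule relpow_Suc_I2[OF _ torus_dist_relpow]) (simp add: vw)
  then have "Suc m \<le> Suc (torus_dist w d)"
    using torus_dist_le[of v d] m by (simp only:)
  moreover have "torus_dist w d \<le> m"
    using wd by (rule torus_dist_le)
  ultimately show ?thesis
    using vw m unfolding next_nodes_def by fastforce
qed

text \<open>A subprobability in its last argument; the missing mass is the probability of leaving
  the network.\<close>

definition route :: "('k::nontriv, 'l::nontriv) torus \<Rightarrow> ('k, 'l) torus \<Rightarrow> ('k, 'l) torus \<Rightarrow> real" where
  "route v d w = (if torus_dist v d \<le> 1 then 0 else of_bool (w \<in> next_nodes v d) / card (next_nodes v d))"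

lemma route_self [simp]: "route v d v = 0"
  by (simp add: route_def next_nodes_def)

lemma sum_route: "(\<Sum>w\<in>UNIV. route v d w) = of_bool (\<not> torus_dist v d \<le> 1)"
proof (cases "torus_dist v d \<le> 1")
  case False
  then have "card (next_nodes v d) \<noteq> 0"
    using next_nodes_nonempty by (simp add: card_eq_0_iff)
  moreover have "(\<Sum>w\<in>UNIV. of_bool (w \<in> next_nodes v d)) = real (card (next_nodes v d))"
    by simp
  ultimately show ?thesis
    using False by (simp add: route_def sum_divide_distrib[symmetric])
qed (simp add: route_def)

text \<open>Each node outside the unit ball around \<open>d\<close> sends total mass 1 and the five
  nodes inside send none. The constant 5 of the theorem comes from here.\<close>

lemma sum_route_pairs:
  fixes d :: "('k::nontriv, 'l::nontriv) torus"
  assumes "CARD('k) \<ge> 3" and "CARD('l) \<ge> 3"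
  shows "(\<Sum>x | fst x \<noteq> snd x. route (snd x) d (fst x)) = real CARD(('k, 'l) torus) - 5"
proof -
  have "(\<Sum>x | fst x \<noteq> snd x. route (snd x) d (fst x)) = (\<Sum>x\<in>UNIV. route (snd x) d (fst x))"
    by (rule sum.mono_neutral_left) auto
  also have "\<dots> = (\<Sum>w\<in>UNIV. \<Sum>v\<in>UNIV. route v d w)"
    by (simp add: sum.cartesian_product split_def)
  also have "\<dots> = (\<Sum>v\<in>UNIV. \<Sum>w\<in>UNIV. route v d w)"
    by (rule sum.swap)
  also have "\<dots> = real (card (- {v. torus_dist v d \<le> 1}))"
    unfolding sum_route by (simp add: Compl_eq)
  also have "\<dots> = real CARD(('k, 'l) torus) - 5"
  proof -
    let ?B = "{v. torus_dist v d \<le> 1}"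
    have "card (- ?B) = CARD(('k, 'l) torus) - card ?B"
      unfolding Compl_eq_Diff_UNIV by (rule card_Diff_subset) auto
    moreover have "card ?B \<le> CARD(('k, 'l) torus)"
      by (rule card_mono) auto
    ultimately show ?thesis
      unfolding card_torus_ball[OF assms] by (simp only: of_nat_diff of_nat_numeral)
  qed
  finally show ?thesis .
qed

lemma expectation_service_pmf:
  fixes F :: "('k::nontriv, 'l::nontriv) config \<Rightarrow> real"
  assumes "\<eta> v \<noteq> []"
  defines "d \<equiv> hd (\<eta> v)" and "\<eta>' \<equiv> \<eta>(v := tl (\<eta> v))"
  shows "measure_pmf.expectation (service_pmf v \<eta>) F
    = of_bool (torus_dist v d \<le> 1) * F \<eta>' + (\<Sum>w\<in>UNIV. route v d w * F (\<eta>'(w := \<eta>' w @ [d])))"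
proof (cases "torus_dist v d \<le> 1")
  case True
  then show ?thesis
    by (simp add: service_pmf_def d_def \<eta>'_def Let_def route_def)
next
  case False
  have "measure_pmf.expectation (service_pmf v \<eta>) F
      = (\<Sum>w\<in>next_nodes v d. F (\<eta>'(w := \<eta>' w @ [d]))) / card (next_nodes v d)"
    unfolding service_pmf_def Let_def d_def[symmetric] \<eta>'_def[symmetric] next_nodes_def[symmetric]
    using False next_nodes_nonempty[OF False] by (simp add: integral_pmf_of_set)
  also have "\<dots> = (\<Sum>w\<in>UNIV. route v d w * F (\<eta>'(w := \<eta>' w @ [d])))"
    using False by (simp add: route_def sum_divide_distrib of_bool_def if_distrib[of "\<lambda>x. x * _"]
        if_distrib[of "\<lambda>x. x / _"] sum.If_cases)
  finally show ?thesis
    using False by simp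
qed

section \<open>The generator of the network\<close>

text \<open>Organised by clocks and not by target configurations: several clocks may produce the
  same target, and a ring that changes nothing contributes 0.\<close>

definition generator ::
  "(('k::nontriv, 'l::nontriv) torus \<Rightarrow> ('k, 'l) torus \<Rightarrow> real) \<Rightarrow> real
    \<Rightarrow> (('k, 'l) config \<Rightarrow> real) \<Rightarrow> ('k, 'l) config \<Rightarrow> real" where
  "generator arr \<beta> F \<eta> =
     (\<Sum>v\<in>UNIV. \<Sum>w\<in>UNIV. arr v w * (F (\<eta>(v := \<eta> v @ [w])) - F \<eta>))
   + (\<Sum>v | \<eta> v \<noteq> []. measure_pmf.expectation (service_pmf v \<eta>) F - F \<eta>)
   + \<beta> * (\<Sum>e\<in>torus_edges. F (\<eta> \<circ> edge_swap e) - F \<eta>)"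

lemma finite_set_service_pmf: "finite (set_pmf (service_pmf v \<eta>))"
proof -
  let ?\<eta> = "\<eta>(v := tl (\<eta> v))"
  have "set_pmf (service_pmf v \<eta>) \<subseteq> insert ?\<eta> (range (\<lambda>w. ?\<eta>(w := ?\<eta> w @ [hd (\<eta> v)])))"
    unfolding service_pmf_def Let_def
    by (cases "torus_dist v (hd (\<eta> v)) \<le> 1") (simp_all add: image_mono subset_insertI2)
  then show ?thesis
    by (rule finite_subset) simp
qed

lemma network_rate_edge_swap:
  "network_rate arr \<beta> \<eta> \<zeta> =
     (\<Sum>v\<in>UNIV. \<Sum>w\<in>UNIV. arr v w * of_bool (\<zeta> = \<eta>(v := \<eta> v @ [w])))
   + (\<Sum>v | \<eta> v \<noteq> []. pmf (service_pmf v \<eta>) \<zeta>)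
   + \<beta> * (\<Sum>e\<in>torus_edges. of_bool (\<zeta> = \<eta> \<circ> edge_swap e))"
proof -
  have "(\<exists>v w. e = {v, w} \<and> v \<noteq> w \<and> \<zeta> = \<eta> \<circ> Transposition.transpose v w) \<longleftrightarrow> \<zeta> = \<eta> \<circ> edge_swap e"
    if "e \<in> torus_edges" for e
  proof -
    from that obtain v w where e: "e = {v, w}" "adj v w"
      by (auto simp: torus_edges_def)
    then have "v \<noteq> w" by auto
    then show ?thesis
      unfolding e(1) using edge_swap_eq by metis
  qed
  then have "{e \<in> torus_edges. \<exists>v w. e = {v, w} \<and> v \<noteq> w \<and> \<zeta> = \<eta> \<circ> Transposition.transpose v w}
      = torus_edges \<inter> {e. \<zeta> = \<eta> \<circ> edge_swap e}"
    by blast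
  then show ?thesis
    unfolding network_rate_def by simp
qed

lemma sum_network_rate:
  fixes arr :: "('k::nontriv, 'l::nontriv) torus \<Rightarrow> ('k, 'l) torus \<Rightarrow> real"
    and F :: "('k, 'l) config \<Rightarrow> real"
  obtains A where "finite A" and "{\<zeta>. network_rate arr \<beta> \<eta> \<zeta> \<noteq> 0} \<subseteq> A"
    and "(\<Sum>\<zeta>\<in>A. network_rate arr \<beta> \<eta> \<zeta> * (F \<zeta> - F \<eta>)) = generator arr \<beta> F \<eta>"
proof
  let ?E = "(\<lambda>e. \<eta> \<circ> edge_swap e) ` torus_edges"
  let ?S = "\<Union>v. set_pmf (service_pmf v \<eta>)"
  let ?R = "\<Union>v. \<Union>w. {\<eta>(v := \<eta> v @ [w])}"
  \<comment> \<open>The support is enlarged by the outcomes of all clocks, so that each indicator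
    can be summed over \<open>?A\<close> even if the rate of its outcome is zero.\<close>
  let ?A = "{\<zeta>. network_rate arr \<beta> \<eta> \<zeta> \<noteq> 0} \<union> ?R \<union> ?S \<union> ?E"
  show fin: "finite ?A"
    using finite_network_rate_support finite_set_service_pmf by (intro finite_UnI finite_UN_I) auto
  show "{\<zeta>. network_rate arr \<beta> \<eta> \<zeta> \<noteq> 0} \<subseteq> ?A"
    by blast
  define D where "D \<zeta> = F \<zeta> - F \<eta>" for \<zeta>
  define A where "A = ?A"
  have finA: "finite A" using fin by (simp only: A_def)
  have point: "(\<Sum>\<zeta>\<in>A. c * of_bool (\<zeta> = \<xi>) * D \<zeta>) = c * D \<xi>" if "\<xi> \<in> A" for c \<xi>
  proof -
    have "(\<Sum>\<zeta>\<in>A. c * of_bool (\<zeta> = \<xi>) * D \<zeta>) = (\<Sum>\<zeta>\<in>A. if \<zeta> = \<xi> then c * D \<zeta> else 0)"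
      by (intro sum.cong) auto
    then show ?thesis using finA that by simp
  qed
  have arr: "(\<Sum>\<zeta>\<in>A. (\<Sum>v\<in>UNIV. \<Sum>w\<in>UNIV. arr v w * of_bool (\<zeta> = \<eta>(v := \<eta> v @ [w]))) * D \<zeta>)
      = (\<Sum>v\<in>UNIV. \<Sum>w\<in>UNIV. arr v w * D (\<eta>(v := \<eta> v @ [w])))"
    unfolding sum_distrib_right
    by (subst sum.swap, intro sum.cong refl, subst sum.swap, intro sum.cong refl point,
      unfold A_def, blast)
  have service: "(\<Sum>\<zeta>\<in>A. (\<Sum>v | \<eta> v \<noteq> []. pmf (service_pmf v \<eta>) \<zeta>) * D \<zeta>)
      = (\<Sum>v | \<eta> v \<noteq> []. measure_pmf.expectation (service_pmf v \<eta>) F - F \<eta>)"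
    unfolding sum_distrib_right
  proof (subst sum.swap, intro sum.cong refl)
    fix v
    have sub: "set_pmf (service_pmf v \<eta>) \<subseteq> A"
      unfolding A_def by blast
    have "measure_pmf.expectation (service_pmf v \<eta>) F = (\<Sum>\<zeta>\<in>A. pmf (service_pmf v \<eta>) \<zeta> * F \<zeta>)"
      using sub by (subst integral_measure_pmf[OF finA]) auto
    moreover have "(\<Sum>\<zeta>\<in>A. pmf (service_pmf v \<eta>) \<zeta>) = 1"
      by (rule sum_pmf_eq_1[OF finA sub])
    ultimately show "(\<Sum>\<zeta>\<in>A. pmf (service_pmf v \<eta>) \<zeta> * D \<zeta>)
        = measure_pmf.expectation (service_pmf v \<eta>) F - F \<eta>"
      by (simp add: D_def right_diff_distrib sum_subtractf sum_distrib_right[symmetric])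
  qed
  have swap: "(\<Sum>\<zeta>\<in>A. (\<Sum>e\<in>torus_edges. of_bool (\<zeta> = \<eta> \<circ> edge_swap e)) * D \<zeta>)
      = (\<Sum>e\<in>torus_edges. D (\<eta> \<circ> edge_swap e))"
    unfolding sum_distrib_right
  proof (subst sum.swap, intro sum.cong refl)
    fix e :: "('k, 'l) torus set" assume "e \<in> torus_edges"
    then have "\<eta> \<circ> edge_swap e \<in> A"
      unfolding A_def by blast
    from point[OF this, of 1] show "(\<Sum>\<zeta>\<in>A. of_bool (\<zeta> = \<eta> \<circ> edge_swap e) * D \<zeta>) = D (\<eta> \<circ> edge_swap e)"
      by simp
  qed
  have "(\<Sum>\<zeta>\<in>A. network_rate arr \<beta> \<eta> \<zeta> * D \<zeta>) = generator arr \<beta> F \<eta>"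
    unfolding network_rate_edge_swap distrib_right sum.distrib arr service mult.assoc
      sum_distrib_left[symmetric] swap
    by (simp add: generator_def D_def)
  then show "(\<Sum>\<zeta>\<in>?A. network_rate arr \<beta> \<eta> \<zeta> * (F \<zeta> - F \<eta>)) = generator arr \<beta> F \<eta>"
    unfolding D_def A_def .
qed

lemma network_rate_nonneg:
  assumes "\<And>v w. arr v w \<ge> 0" and "\<beta> \<ge> 0"
  shows "network_rate arr \<beta> \<eta> \<zeta> \<ge> 0"
  unfolding network_rate_def using assms by (intro add_nonneg_nonneg sum_nonneg mult_nonneg_nonneg) auto

lemma network_rate_arrival_pos:
  assumes nonneg: "\<And>v w. arr v w \<ge> 0" and "\<beta> \<ge> 0" and pos: "arr v w > 0"
  shows "network_rate arr \<beta> \<eta> (\<eta>(v := \<eta> v @ [w])) > 0"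
proof -
  let ?\<zeta> = "\<eta>(v := \<eta> v @ [w])"
  have "0 < arr v w * of_bool (?\<zeta> = \<eta>(v := \<eta> v @ [w]))"
    using pos by simp
  also have "\<dots> \<le> (\<Sum>w'\<in>UNIV. arr v w' * of_bool (?\<zeta> = \<eta>(v := \<eta> v @ [w'])))"
    using nonneg by (intro member_le_sum[where f = "\<lambda>w'. arr v w' * of_bool (?\<zeta> = \<eta>(v := \<eta> v @ [w']))"]) auto
  also have "\<dots> \<le> (\<Sum>v'\<in>UNIV. \<Sum>w'\<in>UNIV. arr v' w' * of_bool (?\<zeta> = \<eta>(v' := \<eta> v' @ [w'])))"
    using nonneg by (intro member_le_sum[where
          f = "\<lambda>v'. \<Sum>w'\<in>UNIV. arr v' w' * of_bool (?\<zeta> = \<eta>(v' := \<eta> v' @ [w']))"] sum_nonneg) auto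
  also have "\<dots> \<le> network_rate arr \<beta> \<eta> ?\<zeta>"
    unfolding network_rate_def using \<open>\<beta> \<ge> 0\<close> by (simp add: sum_nonneg)
  finally show ?thesis .
qed

lemma exit_rate_finite_support:
  assumes "finite A" and "{y. q x y \<noteq> 0} \<subseteq> A"
  shows "exit_rate q x = (\<Sum>y\<in>A - {x}. q x y)"
  unfolding exit_rate_def using assms
  by (subst infsum_cong_neutral[where T = "A - {x}" and g = "q x"]) auto

lemma exit_rate_network_pos:
  assumes nonneg: "\<And>v w. arr v w \<ge> 0" and \<beta>: "\<beta> \<ge> 0" and pos: "arr v w > 0"
  shows "exit_rate (network_rate arr \<beta>) \<eta> > 0"
proof -
  define \<zeta> where "\<zeta> = \<eta>(v := \<eta> v @ [w])"
  have "\<zeta> v \<noteq> \<eta> v" by (simp add: \<zeta>_def)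
  then have neq: "\<zeta> \<noteq> \<eta>" by metis
  have \<zeta>: "network_rate arr \<beta> \<eta> \<zeta> > 0"
    unfolding \<zeta>_def using assms by (rule network_rate_arrival_pos)
  let ?A = "{\<zeta>. network_rate arr \<beta> \<eta> \<zeta> \<noteq> 0}"
  have "exit_rate (network_rate arr \<beta>) \<eta> = (\<Sum>\<zeta>\<in>?A - {\<eta>}. network_rate arr \<beta> \<eta> \<zeta>)"
    by (intro exit_rate_finite_support finite_network_rate_support) auto
  also have "\<dots> \<ge> network_rate arr \<beta> \<eta> \<zeta>"
    using \<zeta> neq
    by (intro member_le_sum finite_Diff finite_network_rate_support network_rate_nonneg[OF nonneg \<beta>]) simp
  finally show ?thesis
    using \<zeta> by simp
qed

lemma pmf_jump_network:
  assumes "\<And>v w. arr v w \<ge> 0" and "\<beta> \<ge> 0" and "exit_rate (network_rate arr \<beta>) \<eta> > 0"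
  shows "pmf (jump_pmf (network_rate arr \<beta>) \<eta>) \<zeta>
    = (if \<zeta> = \<eta> then 0 else network_rate arr \<beta> \<eta> \<zeta> / exit_rate (network_rate arr \<beta>) \<eta>)"
proof (rule pmf_jump_pmf)
  show "finite {\<zeta>. \<zeta> \<noteq> \<eta> \<and> network_rate arr \<beta> \<eta> \<zeta> \<noteq> 0}"
    by (rule finite_subset[OF _ finite_network_rate_support]) auto
qed (use assms(3) network_rate_nonneg[OF assms(1,2)] in auto)

lemma finite_set_jump_network:
  assumes "\<And>v w. arr v w \<ge> 0" and "\<beta> \<ge> 0" and "exit_rate (network_rate arr \<beta>) \<eta> > 0"
  shows "finite (set_pmf (jump_pmf (network_rate arr \<beta>) \<eta>))"
  by (rule finite_subset[OF _ finite_network_rate_support])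
    (auto simp: set_pmf_iff pmf_jump_network[OF assms] split: if_splits)

text \<open>Reduces superharmonicity for the jump chain to the sign of the generator. On the
  diagonal \<open>network_rate\<close> may be nonzero, for instance when equal queues are swapped,
  but there the factor \<open>F \<zeta> - F \<eta>\<close> vanishes.\<close>

lemma expectation_jump_network:
  fixes F :: "('k::nontriv, 'l::nontriv) config \<Rightarrow> real"
  assumes "\<And>v w. arr v w \<ge> 0" and "\<beta> \<ge> 0" and pos: "exit_rate (network_rate arr \<beta>) \<eta> > 0"
  shows "measure_pmf.expectation (jump_pmf (network_rate arr \<beta>) \<eta>) F
    = F \<eta> + generator arr \<beta> F \<eta> / exit_rate (network_rate arr \<beta>) \<eta>"
proof -
  let ?p = "jump_pmf (network_rate arr \<beta>) \<eta>" and ?x = "exit_rate (network_rate arr \<beta>) \<eta>"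
  note pmf = pmf_jump_network[OF assms]
  obtain A where A: "finite A" "{\<zeta>. network_rate arr \<beta> \<eta> \<zeta> \<noteq> 0} \<subseteq> A"
    and gen: "(\<Sum>\<zeta>\<in>A. network_rate arr \<beta> \<eta> \<zeta> * (F \<zeta> - F \<eta>)) = generator arr \<beta> F \<eta>"
    by (rule sum_network_rate[of arr \<beta> \<eta> F])
  have sub: "set_pmf ?p \<subseteq> A"
    using A(2) by (auto simp: set_pmf_iff pmf split: if_splits)
  have "measure_pmf.expectation ?p F - F \<eta> = (\<Sum>\<zeta>\<in>A. pmf ?p \<zeta> * (F \<zeta> - F \<eta>))"
    using sub by (subst integral_measure_pmf[OF A(1)])
      (auto simp: right_diff_distrib sum_subtractf sum_distrib_right[symmetric] sum_pmf_eq_1[OF A(1) sub])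
  also have "\<dots> = (\<Sum>\<zeta>\<in>A. network_rate arr \<beta> \<eta> \<zeta> * (F \<zeta> - F \<eta>) / ?x)"
    by (intro sum.cong refl) (simp add: pmf)
  also have "\<dots> = generator arr \<beta> F \<eta> / ?x"
    by (simp add: sum_divide_distrib[symmetric] gen)
  finally show ?thesis by simp
qed

section \<open>The Lyapunov function\<close>

lemma exp_minus_le_quadratic:
  fixes x :: real
  assumes "\<bar>x\<bar> \<le> 1"
  shows "exp (- x) \<le> 1 - x + x\<^sup>2"
proof (cases "x \<le> 0")
  case True
  then show ?thesis
    using exp_bound[of "- x"] assms by simp
next
  case False
  have "exp (- x) = 1 / exp x"
    by (simp add: exp_minus field_simps)
  also have "\<dots> \<le> 1 / (1 + x)"
    using False exp_ge_add_one_self[of x] by (intro divide_left_mono) auto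
  also have "\<dots> \<le> 1 - x + x\<^sup>2"
  proof -
    have "(1 - x + x\<^sup>2) * (1 + x) = 1 + x ^ 3"
      by (simp add: algebra_simps power2_eq_square power3_eq_cube)
    then show ?thesis
      using False by (simp add: divide_le_eq)
  qed
  finally show ?thesis .
qed

text \<open>Second-order expansion: the linear term will produce the drift, and the remainder is
  quadratic in \<epsilon>.\<close>

lemma exp_increment_le:
  fixes \<epsilon> :: real
  assumes "\<epsilon> > 0" and "\<epsilon> * B \<le> 1" and "\<bar>b\<bar> \<le> B"
  shows "exp (- \<epsilon> * (a + b)) - exp (- \<epsilon> * a) \<le> exp (- \<epsilon> * a) * (- \<epsilon> * b + (\<epsilon> * B)\<^sup>2)"
proof -
  have eb: "\<bar>\<epsilon> * b\<bar> \<le> \<epsilon> * B"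
    using assms by (simp add: abs_mult mult_left_mono)
  then have "exp (- (\<epsilon> * b)) \<le> 1 - \<epsilon> * b + (\<epsilon> * b)\<^sup>2"
    using assms(2) by (intro exp_minus_le_quadratic) linarith
  also have "(\<epsilon> * b)\<^sup>2 \<le> (\<epsilon> * B)\<^sup>2"
    using eb by (metis abs_ge_zero power2_abs power_mono)
  finally have "exp (- (\<epsilon> * b)) - 1 \<le> - \<epsilon> * b + (\<epsilon> * B)\<^sup>2"
    by simp
  then have "exp (- \<epsilon> * a) * (exp (- (\<epsilon> * b)) - 1) \<le> exp (- \<epsilon> * a) * (- \<epsilon> * b + (\<epsilon> * B)\<^sup>2)"
    by (intro mult_left_mono) auto
  moreover have "exp (- \<epsilon> * (a + b)) = exp (- \<epsilon> * a) * exp (- (\<epsilon> * b))"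
    by (simp add: exp_add[symmetric] algebra_simps)
  ultimately show ?thesis
    by (simp add: algebra_simps)
qed

text \<open>In the application \<open>m0\<close> is the mean routing probability over pairs of
  distinct nodes. \<open>M\<close> is the depth at which the correction is truncated,
  \<open>C\<close> a crude bound on the levels up to \<open>M\<close>, and \<delta> the error left
  at level \<open>M\<close>.\<close>

locale queue_lyapunov =
  fixes arr :: "('k::nontriv, 'l::nontriv) torus \<Rightarrow> ('k, 'l) torus \<Rightarrow> real"
    and \<beta> lam m0 C \<delta> :: real
    and \<psi> :: "nat \<Rightarrow> ('k, 'l) torus \<Rightarrow> ('k, 'l) torus \<times> ('k, 'l) torus \<Rightarrow> real"
    and M :: nat
  assumes arr_nonneg: "\<And>v w. arr v w \<ge> 0" and sum_arr: "\<And>v. (\<Sum>w\<in>UNIV. arr v w) = lam"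
    and beta_nonneg: "\<beta> \<ge> 0"
    and psi_0: "\<And>d p k. p \<noteq> k \<Longrightarrow> \<psi> 0 d (p, k) = route k d p - m0"
    and psi_Suc: "\<And>i d x. \<psi> i d x = \<psi> (Suc i) d x
      + \<beta> * (\<Sum>e\<in>torus_edges. \<psi> (Suc i) d x - \<psi> (Suc i) d (map_prod (edge_swap e) (edge_swap e) x))"
    and psi_bound: "\<And>i d x. i \<le> M \<Longrightarrow> \<bar>\<psi> i d x\<bar> \<le> C"
    and psi_M: "\<And>d p k. p \<noteq> k \<Longrightarrow> \<bar>\<psi> M d (p, k)\<bar> \<le> \<delta>"
begin

text \<open>
  A customer with destination \<open>d\<close> at position \<open>i\<close> of the queue at \<open>k\<close> completes its service after
  \<open>i + 1\<close> rings of the clock of that queue. If \<open>(p, k)\<close> is the position of two tagged queues that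
  are only moved by swaps, then \<open>\<psi> (i + 1) d (p, k)\<close> is, up to centering, the probability that this
  customer is then routed to the first queue.
\<close>

definition tail_weight :: "('k, 'l) torus \<Rightarrow> ('k, 'l) torus \<Rightarrow> ('k, 'l) torus list \<Rightarrow> real" where
  "tail_weight p k xs = (\<Sum>i<M. \<psi> (Suc i) (xs ! i) (p, k))"

definition potential :: "('k, 'l) torus \<Rightarrow> ('k, 'l) config \<Rightarrow> real" where
  "potential p \<eta> = real (length (\<eta> p)) + (\<Sum>k\<in>-{p}. tail_weight p k (\<eta> k))"

text \<open>Covers also lists shorter than \<open>M\<close>, where \<open>xs ! i\<close> is
  unspecified: \<open>psi_bound\<close> holds for every destination.\<close>

lemma abs_tail_weight_le: "\<bar>tail_weight p k xs\<bar> \<le> M * C"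
proof -
  have "\<bar>tail_weight p k xs\<bar> \<le> (\<Sum>i<M. \<bar>\<psi> (Suc i) (xs ! i) (p, k)\<bar>)"
    unfolding tail_weight_def by (rule sum_abs)
  also have "\<dots> \<le> (\<Sum>i<M. C)"
    by (intro sum_mono psi_bound) simp
  finally show ?thesis by simp
qed

lemma C_nonneg: "C \<ge> 0"
  using psi_bound[of 0 undefined undefined] by linarith

lemma sum_Compl_const_le: "c \<ge> 0 \<Longrightarrow> (\<Sum>k\<in>-{p::('k, 'l) torus}. c) \<le> real CARD(('k, 'l) torus) * (c::real)"
  by (simp add: card_mono mult_right_mono del: card_prod CARD_mod_ring)

lemma abs_potential_minus_length_le:
  "\<bar>potential p \<eta> - real (length (\<eta> p))\<bar> \<le> real CARD(('k, 'l) torus) * (M * C)"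
proof -
  have "\<bar>\<Sum>k\<in>-{p}. tail_weight p k (\<eta> k)\<bar> \<le> (\<Sum>k\<in>-{p}. M * C)"
    by (rule order_trans[OF sum_abs sum_mono]) (rule abs_tail_weight_le)
  also have "\<dots> \<le> real CARD(('k, 'l) torus) * (M * C)"
    by (intro sum_Compl_const_le) (simp add: C_nonneg)
  finally show ?thesis
    by (simp add: potential_def)
qed

lemma tail_weight_append: "M \<le> length xs \<Longrightarrow> tail_weight p k (xs @ ys) = tail_weight p k xs"
  unfolding tail_weight_def by (intro sum.cong refl) (simp add: nth_append)

text \<open>The new customer takes a position of index at least \<open>M\<close>, which the
  correction does not see.\<close>

lemma potential_append:
  assumes "M \<le> length (\<eta> v)"
  shows "potential p (\<eta>(v := \<eta> v @ [w])) = potential p \<eta> + of_bool (v = p)"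
proof -
  have "tail_weight p k ((\<eta>(v := \<eta> v @ [w])) k) = tail_weight p k (\<eta> k)" for k
    using assms by (simp add: tail_weight_append)
  then show ?thesis
    unfolding potential_def by simp
qed

definition service_increment :: "('k, 'l) torus \<Rightarrow> ('k, 'l) torus \<Rightarrow> ('k, 'l) torus list \<Rightarrow> real" where
  "service_increment p v xs
    = of_bool (v \<noteq> p) * (tail_weight p v (tl xs) - tail_weight p v xs) - of_bool (v = p)"

lemma potential_service:
  assumes "\<eta> v \<noteq> []"
  shows "potential p (\<eta>(v := tl (\<eta> v))) = potential p \<eta> + service_increment p v (\<eta> v)"
proof (cases "v = p")
  case True
  have "(\<Sum>k\<in>-{p}. tail_weight p k ((\<eta>(v := tl (\<eta> v))) k)) = (\<Sum>k\<in>-{p}. tail_weight p k (\<eta> k))"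
    using True by (intro sum.cong) auto
  moreover have "real (length (tl (\<eta> p))) = real (length (\<eta> p)) - 1"
    using assms True by (cases "\<eta> p") auto
  ultimately show ?thesis
    using True by (simp add: potential_def service_increment_def)
next
  case False
  have "(\<Sum>k\<in>-{p}. tail_weight p k ((\<eta>(v := tl (\<eta> v))) k))
      = tail_weight p v (tl (\<eta> v)) + (\<Sum>k\<in>-{p} - {v}. tail_weight p k (\<eta> k))"
    using False by (subst sum.remove[of _ v]) auto
  moreover have "(\<Sum>k\<in>-{p}. tail_weight p k (\<eta> k))
      = tail_weight p v (\<eta> v) + (\<Sum>k\<in>-{p} - {v}. tail_weight p k (\<eta> k))"
    using False by (subst sum.remove[of _ v]) auto
  ultimately show ?thesis
    using False by (simp add: potential_def service_increment_def)
qed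

definition swap_increment :: "('k, 'l) torus \<Rightarrow> ('k, 'l) torus set \<Rightarrow> ('k, 'l) config \<Rightarrow> real" where
  "swap_increment p e \<eta>
    = (\<Sum>k\<in>-{p}. tail_weight (edge_swap e p) (edge_swap e k) (\<eta> k) - tail_weight p k (\<eta> k))"

text \<open>The tagged queue is followed through the swap, so its length is unchanged and only the
  pairs of locations in the correction move.\<close>

lemma potential_swap:
  "potential (edge_swap e p) (\<eta> \<circ> edge_swap e) = potential p \<eta> + swap_increment p e \<eta>"
proof -
  have "(\<Sum>k\<in>-{edge_swap e p}. tail_weight (edge_swap e p) k (\<eta> (edge_swap e k)))
      = (\<Sum>k\<in>-{p}. tail_weight (edge_swap e p) (edge_swap e k) (\<eta> k))"
    by (rule sum.reindex_bij_witness[where i = "edge_swap e" and j = "edge_swap e"]) auto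
  then show ?thesis
    by (simp add: potential_def swap_increment_def sum_subtractf)
qed

text \<open>The mean rate of change of \<open>potential p\<close>, with the tagged queue followed
  through swaps, as long as all queues are longer than \<open>M\<close>.\<close>

definition drift :: "('k, 'l) torus \<Rightarrow> ('k, 'l) config \<Rightarrow> real" where
  "drift p \<eta> = lam + (\<Sum>v\<in>UNIV. service_increment p v (\<eta> v) + route v (hd (\<eta> v)) p)
    + \<beta> * (\<Sum>e\<in>torus_edges. swap_increment p e \<eta>)"

text \<open>By \<open>psi_Suc\<close> the swaps lower the level of \<psi> by one at each position,
  while a service moves each customer up one position. The combined sum telescopes: level 0 cancels
  \<open>route\<close> up to \<open>m0\<close>, and only level \<open>M\<close> remains.\<close>

lemma tail_weight_drift:
  assumes "p \<noteq> k" and len: "M < length xs"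
  shows "tail_weight p k (tl xs) - tail_weight p k xs + route k (hd xs) p
      + \<beta> * (\<Sum>e\<in>torus_edges. tail_weight (edge_swap e p) (edge_swap e k) xs - tail_weight p k xs)
    = m0 + \<psi> M (xs ! M) (p, k)"
proof -
  let ?T = "\<lambda>e x. map_prod (edge_swap e) (edge_swap e) (x :: ('k, 'l) torus \<times> ('k, 'l) torus)"
  have rec: "\<beta> * (\<Sum>e\<in>torus_edges. \<psi> (Suc i) d (?T e (p, k)) - \<psi> (Suc i) d (p, k))
      = \<psi> (Suc i) d (p, k) - \<psi> i d (p, k)" for i d
  proof -
    have "(\<Sum>e\<in>torus_edges. \<psi> (Suc i) d (?T e (p, k)) - \<psi> (Suc i) d (p, k))
        = - (\<Sum>e\<in>torus_edges. \<psi> (Suc i) d (p, k) - \<psi> (Suc i) d (?T e (p, k)))"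
      by (simp add: sum_negf[symmetric])
    then show ?thesis
      using psi_Suc[of i d "(p, k)"] by (simp only: mult_minus_right)
  qed
  have "\<beta> * (\<Sum>e\<in>torus_edges. tail_weight (edge_swap e p) (edge_swap e k) xs - tail_weight p k xs)
      = \<beta> * (\<Sum>e\<in>torus_edges. \<Sum>i<M. \<psi> (Suc i) (xs ! i) (?T e (p, k)) - \<psi> (Suc i) (xs ! i) (p, k))"
    by (simp add: tail_weight_def sum_subtractf)
  also have "\<dots> = (\<Sum>i<M. \<beta> * (\<Sum>e\<in>torus_edges. \<psi> (Suc i) (xs ! i) (?T e (p, k)) - \<psi> (Suc i) (xs ! i) (p, k)))"
    by (subst sum.swap) (rule sum_distrib_left)
  also have "\<dots> = tail_weight p k xs - (\<Sum>i<M. \<psi> i (xs ! i) (p, k))"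
    unfolding rec by (simp add: sum_subtractf tail_weight_def)
  finally have swap: "\<beta> * (\<Sum>e\<in>torus_edges. tail_weight (edge_swap e p) (edge_swap e k) xs - tail_weight p k xs)
      = tail_weight p k xs - (\<Sum>i<M. \<psi> i (xs ! i) (p, k))" .
  \<comment> \<open>After the service the entry \<open>xs ! M\<close> is read; hence the strict
    inequality in \<open>len\<close>.\<close>
  have "tail_weight p k (tl xs) = (\<Sum>i<M. \<psi> (Suc i) (xs ! Suc i) (p, k))"
    unfolding tail_weight_def using len by (intro sum.cong refl) (simp add: nth_tl)
  moreover have "(\<Sum>i<M. \<psi> (Suc i) (xs ! Suc i) (p, k)) - (\<Sum>i<M. \<psi> i (xs ! i) (p, k))
      = \<psi> M (xs ! M) (p, k) - \<psi> 0 (xs ! 0) (p, k)"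
    unfolding sum_subtractf[symmetric] by (rule sum_lessThan_telescope)
  moreover have "\<psi> 0 (xs ! 0) (p, k) = route k (hd xs) p - m0"
  proof -
    have "xs \<noteq> []" using len by auto
    then show ?thesis
      by (simp add: psi_0[OF \<open>p \<noteq> k\<close>] hd_conv_nth)
  qed
  ultimately show ?thesis
    unfolding swap by linarith
qed

lemma drift_eq:
  assumes len: "\<And>v. M < length (\<eta> v)"
  shows "drift p \<eta> = lam - 1 + (\<Sum>k\<in>-{p}. m0 + \<psi> M (\<eta> k ! M) (p, k))"
proof -
  have "(\<Sum>v\<in>UNIV. service_increment p v (\<eta> v) + route v (hd (\<eta> v)) p)
      = -1 + (\<Sum>k\<in>-{p}. tail_weight p k (tl (\<eta> k)) - tail_weight p k (\<eta> k) + route k (hd (\<eta> k)) p)"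
  proof -
    have "(\<Sum>v\<in>UNIV. service_increment p v (\<eta> v) + route v (hd (\<eta> v)) p)
        = service_increment p p (\<eta> p) + route p (hd (\<eta> p)) p
        + (\<Sum>v\<in>UNIV - {p}. service_increment p v (\<eta> v) + route v (hd (\<eta> v)) p)"
      by (rule sum.remove) auto
    also have "(\<Sum>v\<in>UNIV - {p}. service_increment p v (\<eta> v) + route v (hd (\<eta> v)) p)
        = (\<Sum>k\<in>-{p}. tail_weight p k (tl (\<eta> k)) - tail_weight p k (\<eta> k) + route k (hd (\<eta> k)) p)"
      by (intro sum.cong) (auto simp: service_increment_def)
    finally show ?thesis
      by (simp add: service_increment_def)
  qed
  moreover have "\<beta> * (\<Sum>e\<in>torus_edges. swap_increment p e \<eta>)
      = (\<Sum>k\<in>-{p}. \<beta> * (\<Sum>e\<in>torus_edges. tail_weight (edge_swap e p) (edge_swap e k) (\<eta> k) - tail_weight p k (\<eta> k)))"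
    unfolding swap_increment_def by (subst sum.swap) (rule sum_distrib_left)
  ultimately have "drift p \<eta> = lam - 1
      + (\<Sum>k\<in>-{p}. tail_weight p k (tl (\<eta> k)) - tail_weight p k (\<eta> k) + route k (hd (\<eta> k)) p
        + \<beta> * (\<Sum>e\<in>torus_edges. tail_weight (edge_swap e p) (edge_swap e k) (\<eta> k) - tail_weight p k (\<eta> k)))"
    unfolding drift_def by (simp add: sum.distrib)
  also have "(\<Sum>k\<in>-{p}. tail_weight p k (tl (\<eta> k)) - tail_weight p k (\<eta> k) + route k (hd (\<eta> k)) p
        + \<beta> * (\<Sum>e\<in>torus_edges. tail_weight (edge_swap e p) (edge_swap e k) (\<eta> k) - tail_weight p k (\<eta> k)))
      = (\<Sum>k\<in>-{p}. m0 + \<psi> M (\<eta> k ! M) (p, k))"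
    using len by (intro sum.cong refl tail_weight_drift) auto
  finally show ?thesis .
qed

lemma drift_ge:
  assumes "\<And>v. M < length (\<eta> v)" and "\<delta> \<ge> 0"
  shows "drift p \<eta> \<ge> lam - 1 + (real CARD(('k, 'l) torus) - 1) * m0 - real CARD(('k, 'l) torus) * \<delta>"
proof -
  have "card (- {p}) = CARD(('k, 'l) torus) - 1"
    unfolding Compl_eq_Diff_UNIV by (subst card_Diff_singleton) auto
  moreover have "CARD(('k, 'l) torus) \<ge> 1"
    by (simp add: Suc_leI)
  ultimately have card: "real (card (- {p})) = real CARD(('k, 'l) torus) - 1"
    by (simp only: of_nat_diff of_nat_1)
  have "(\<Sum>k\<in>-{p}. m0 - \<delta>) \<le> (\<Sum>k\<in>-{p}. m0 + \<psi> M (\<eta> k ! M) (p, k))"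
  proof (intro sum_mono)
    fix k assume "k \<in> - {p}"
    then show "m0 - \<delta> \<le> m0 + \<psi> M (\<eta> k ! M) (p, k)"
      using psi_M[of p k "\<eta> k ! M"] by auto
  qed
  moreover have "(\<Sum>k\<in>-{p}. m0 - \<delta>) = (real CARD(('k, 'l) torus) - 1) * (m0 - \<delta>)"
    unfolding sum_constant card ..
  moreover have "(real CARD(('k, 'l) torus) - 1) * (m0 - \<delta>)
      \<ge> (real CARD(('k, 'l) torus) - 1) * m0 - real CARD(('k, 'l) torus) * \<delta>"
    using \<open>\<delta> \<ge> 0\<close> by (simp add: algebra_simps)
  ultimately show ?thesis
    unfolding drift_eq[OF assms(1)] by linarith
qed

text \<open>One bound for all jumps: a service together with a routed arrival changes a potential by
  at most \<open>2 + 2 * (M * C)\<close>, a swap by at most \<open>2 * (M * C)\<close> for each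
  other queue.\<close>

definition increment_bound :: real where
  "increment_bound = 2 + 2 * (M * C) + real CARD(('k, 'l) torus) * (2 * (M * C))"

lemma MC_nonneg: "M * C \<ge> 0"
  using C_nonneg by simp

lemma increment_bound_ge: "increment_bound \<ge> 2 + 2 * (M * C)" "increment_bound \<ge> real CARD(('k, 'l) torus) * (2 * (M * C))"
proof -
  have "real CARD(('k, 'l) torus) * (2 * (M * C)) \<ge> 0"
    using C_nonneg by simp
  then show "increment_bound \<ge> 2 + 2 * (M * C)" "increment_bound \<ge> real CARD(('k, 'l) torus) * (2 * (M * C))"
    unfolding increment_bound_def using MC_nonneg by linarith+
qed

lemma abs_service_increment_le: "\<bar>service_increment p v xs\<bar> \<le> 1 + 2 * (M * C)"
  using abs_tail_weight_le[of p v xs] abs_tail_weight_le[of p v "tl xs"] MC_nonneg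
  unfolding service_increment_def by (cases "v = p") auto

lemma abs_swap_increment_le: "\<bar>swap_increment p e \<eta>\<bar> \<le> increment_bound"
proof -
  have "\<bar>swap_increment p e \<eta>\<bar> \<le> (\<Sum>k\<in>-{p}. 2 * (M * C))"
    unfolding swap_increment_def
  proof (rule order_trans[OF sum_abs sum_mono])
    fix k
    show "\<bar>tail_weight (edge_swap e p) (edge_swap e k) (\<eta> k) - tail_weight p k (\<eta> k)\<bar> \<le> 2 * (M * C)"
      using abs_tail_weight_le[of "edge_swap e p" "edge_swap e k" "\<eta> k"] abs_tail_weight_le[of p k "\<eta> k"]
      by linarith
  qed
  also have "\<dots> \<le> real CARD(('k, 'l) torus) * (2 * (M * C))"
    by (intro sum_Compl_const_le) (simp add: C_nonneg)
  finally show ?thesis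
    using increment_bound_ge(2) by linarith
qed

section \<open>The exponential Lyapunov function and its generator\<close>

definition lyapunov :: "real \<Rightarrow> ('k, 'l) config \<Rightarrow> real" where
  "lyapunov \<epsilon> \<eta> = (\<Sum>p\<in>UNIV. exp (- \<epsilon> * potential p \<eta>))"

text \<open>Here \<pi> relabels the tagged queues: the identity for arrivals and services,
  \<open>edge_swap e\<close> for swaps. As \<open>lyapunov\<close> sums over all nodes, the
  relabelling does not change it.\<close>

lemma lyapunov_diff_le:
  assumes "\<epsilon> > 0" and "\<epsilon> * increment_bound \<le> 1"
    and \<zeta>: "\<And>p. potential (\<pi> p) \<zeta> = potential p \<eta> + b p" "\<And>p. \<bar>b p\<bar> \<le> increment_bound"
    and \<pi>: "\<And>p. \<pi> (\<pi> p) = p"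
  shows "lyapunov \<epsilon> \<zeta> - lyapunov \<epsilon> \<eta>
    \<le> (\<Sum>p\<in>UNIV. exp (- \<epsilon> * potential p \<eta>) * (- \<epsilon> * b p + (\<epsilon> * increment_bound)\<^sup>2))"
proof -
  have "lyapunov \<epsilon> \<zeta> = (\<Sum>p\<in>UNIV. exp (- \<epsilon> * potential (\<pi> p) \<zeta>))"
    unfolding lyapunov_def by (rule sum.reindex_bij_witness[where i = \<pi> and j = \<pi>]) (auto simp: \<pi>)
  then have "lyapunov \<epsilon> \<zeta> - lyapunov \<epsilon> \<eta>
      = (\<Sum>p\<in>UNIV. exp (- \<epsilon> * (potential p \<eta> + b p)) - exp (- \<epsilon> * potential p \<eta>))"
    by (simp only: lyapunov_def sum_subtractf \<zeta>(1))
  also have "\<dots> \<le> (\<Sum>p\<in>UNIV. exp (- \<epsilon> * potential p \<eta>) * (- \<epsilon> * b p + (\<epsilon> * increment_bound)\<^sup>2))"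
    using assms by (intro sum_mono exp_increment_le) auto
  finally show ?thesis .
qed

text \<open>\<open>lyapunov_diff_le\<close> is applied to each clock. The linear terms add up to
  \<open>drift\<close>; the quadratic ones are multiplied by the total rate of all clocks.\<close>

lemma generator_lyapunov_le:
  assumes "\<epsilon> > 0" and "\<epsilon> * increment_bound \<le> 1" and len: "\<And>v. M < length (\<eta> v)"
  shows "generator arr \<beta> (lyapunov \<epsilon>) \<eta>
    \<le> (\<Sum>p\<in>UNIV. exp (- \<epsilon> * potential p \<eta>) * (- \<epsilon> * drift p \<eta>
        + (real CARD(('k, 'l) torus) * lam + real CARD(('k, 'l) torus) + \<beta> * card (torus_edges :: ('k, 'l) torus set set))
          * (\<epsilon> * increment_bound)\<^sup>2))"
proof -
  define n where "n = real CARD(('k, 'l) torus)"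
  define G where "G = (torus_edges :: ('k, 'l) torus set set)"
  define a where "a p = exp (- \<epsilon> * potential p \<eta>)" for p
  define r where "r = (\<epsilon> * increment_bound)\<^sup>2"
  let ?L = "lyapunov \<epsilon>"
  note diff = lyapunov_diff_le[OF assms(1,2), where \<eta> = \<eta>, folded a_def r_def]
  have one: "1 \<le> increment_bound"
    using increment_bound_ge(1) MC_nonneg by linarith

  have inner: "(\<Sum>v\<in>UNIV. lam * (- \<epsilon> * of_bool (v = p) + r)) = - \<epsilon> * lam + n * lam * r" for p :: "('k, 'l) torus"
  proof -
    have "(\<Sum>v\<in>UNIV. lam * (- \<epsilon> * of_bool (v = p) + r))
        = (\<Sum>v\<in>UNIV. (if v = p then - \<epsilon> * lam else 0) + lam * r)"
      by (intro sum.cong refl) (simp add: algebra_simps)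
    then show ?thesis
      unfolding sum.distrib sum_constant n_def by (simp del: card_prod CARD_mod_ring)
  qed

  have arrival: "(\<Sum>v\<in>UNIV. \<Sum>w\<in>UNIV. arr v w * (?L (\<eta>(v := \<eta> v @ [w])) - ?L \<eta>))
      \<le> (\<Sum>p\<in>UNIV. a p * (- \<epsilon> * lam + n * lam * r))"
  proof -
    have "(\<Sum>v\<in>UNIV. \<Sum>w\<in>UNIV. arr v w * (?L (\<eta>(v := \<eta> v @ [w])) - ?L \<eta>))
        \<le> (\<Sum>v\<in>UNIV. \<Sum>w\<in>UNIV. arr v w * (\<Sum>p\<in>UNIV. a p * (- \<epsilon> * of_bool (v = p) + r)))"
    proof (intro sum_mono mult_left_mono arr_nonneg)
      fix v w
      show "?L (\<eta>(v := \<eta> v @ [w])) - ?L \<eta> \<le> (\<Sum>p\<in>UNIV. a p * (- \<epsilon> * of_bool (v = p) + r))"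
        using len[of v] one by (intro diff[where \<pi> = "\<lambda>p. p"] potential_append) auto
    qed
    also have "\<dots> = (\<Sum>v\<in>UNIV. \<Sum>p\<in>UNIV. a p * (lam * (- \<epsilon> * of_bool (v = p) + r)))"
      unfolding sum_distrib_right[symmetric] sum_arr by (simp add: sum_distrib_left mult_ac)
    also have "\<dots> = (\<Sum>p\<in>UNIV. a p * (\<Sum>v\<in>UNIV. lam * (- \<epsilon> * of_bool (v = p) + r)))"
      by (subst sum.swap) (simp only: sum_distrib_left)
    finally show ?thesis unfolding inner .
  qed

  have service: "measure_pmf.expectation (service_pmf v \<eta>) ?L - ?L \<eta>
      \<le> (\<Sum>p\<in>UNIV. a p * (- \<epsilon> * (service_increment p v (\<eta> v) + route v (hd (\<eta> v)) p) + r))" for v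
  proof -
    let ?d = "hd (\<eta> v)" and ?s = "\<lambda>p. service_increment p v (\<eta> v)"
    define \<eta>' where "\<eta>' = \<eta>(v := tl (\<eta> v))"
    define b :: real where "b = of_bool (torus_dist v ?d \<le> 1)"
    define U where "U = (\<Sum>p\<in>UNIV. a p * (- \<epsilon> * ?s p + r))"
    have ne: "\<eta> v \<noteq> []" using len[of v] by auto
    have s: "\<bar>?s p\<bar> \<le> increment_bound" "\<bar>?s p + of_bool (w = p)\<bar> \<le> increment_bound" for p w
      using abs_service_increment_le[of p v "\<eta> v"] increment_bound_ge(1) by auto
    \<comment> \<open>The queue at \<open>v\<close> has just lost a customer; the strict bound
      \<open>len\<close> leaves what \<open>potential_append\<close> requires.\<close>
    have len': "M \<le> length (\<eta>' w)" for w
      using len[of w] len[of v] by (auto simp: \<eta>'_def)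
    have leave: "?L \<eta>' - ?L \<eta> \<le> U"
      unfolding U_def \<eta>'_def by (intro diff[where \<pi> = "\<lambda>p. p"] potential_service ne s) auto
    have move: "?L (\<eta>'(w := \<eta>' w @ [?d])) - ?L \<eta> \<le> U - \<epsilon> * a w" for w
    proof -
      have "?L (\<eta>'(w := \<eta>' w @ [?d])) - ?L \<eta> \<le> (\<Sum>p\<in>UNIV. a p * (- \<epsilon> * (?s p + of_bool (w = p)) + r))"
      proof (intro diff[where \<pi> = "\<lambda>p. p"] s)
        fix p
        show "potential p (\<eta>'(w := \<eta>' w @ [?d])) = potential p \<eta> + (?s p + of_bool (w = p))"
          unfolding potential_append[of \<eta>' w, OF len'] by (simp add: \<eta>'_def potential_service[of \<eta> v, OF ne])
      qed simp
      also have "\<dots> = (\<Sum>p\<in>UNIV. a p * (- \<epsilon> * ?s p + r) - (if w = p then \<epsilon> * a p else 0))"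
        by (intro sum.cong refl) (simp add: algebra_simps)
      also have "\<dots> = U - \<epsilon> * a w"
        by (simp add: sum_subtractf U_def)
      finally show ?thesis .
    qed
    have route: "(\<Sum>w\<in>UNIV. route v ?d w) = 1 - b"
      by (simp add: sum_route b_def)
    \<comment> \<open>The coefficient 1 of \<open>?L \<eta>\<close> is split into the probability
      \<open>b\<close> of leaving and the total routing mass, so that each outcome is compared with
      \<open>?L \<eta>\<close> separately.\<close>
    have "measure_pmf.expectation (service_pmf v \<eta>) ?L - ?L \<eta>
        = b * ?L \<eta>' + (\<Sum>w\<in>UNIV. route v ?d w * ?L (\<eta>'(w := \<eta>' w @ [?d])))
          - (b + (\<Sum>w\<in>UNIV. route v ?d w)) * ?L \<eta>"
      unfolding route by (simp add: expectation_service_pmf[of \<eta> v, OF ne] b_def \<eta>'_def)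
    also have "\<dots> = b * (?L \<eta>' - ?L \<eta>) + (\<Sum>w\<in>UNIV. route v ?d w * (?L (\<eta>'(w := \<eta>' w @ [?d])) - ?L \<eta>))"
      by (simp add: algebra_simps sum_subtractf sum_distrib_left)
    also have "\<dots> \<le> b * U + (\<Sum>w\<in>UNIV. route v ?d w * (U - \<epsilon> * a w))"
      by (intro add_mono sum_mono mult_left_mono leave move) (auto simp: b_def route_def)
    also have "\<dots> = b * U + (\<Sum>w\<in>UNIV. route v ?d w) * U - (\<Sum>w\<in>UNIV. route v ?d w * (\<epsilon> * a w))"
      by (simp add: right_diff_distrib sum_subtractf sum_distrib_right)
    also have "\<dots> = U - (\<Sum>w\<in>UNIV. route v ?d w * (\<epsilon> * a w))"
      unfolding route by (simp add: algebra_simps)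
    also have "\<dots> = (\<Sum>p\<in>UNIV. a p * (- \<epsilon> * (?s p + route v ?d p) + r))"
      unfolding U_def sum_subtractf[symmetric] by (intro sum.cong refl) (simp add: algebra_simps)
    finally show ?thesis .
  qed

  have swap: "?L (\<eta> \<circ> edge_swap e) - ?L \<eta> \<le> (\<Sum>p\<in>UNIV. a p * (- \<epsilon> * swap_increment p e \<eta> + r))" for e
    by (intro diff[where \<pi> = "edge_swap e"] potential_swap abs_swap_increment_le) simp

  have "\<eta> v \<noteq> []" for v
    using len[of v] by auto
  then have all: "{v. \<eta> v \<noteq> []} = UNIV"
    by blast
  have "generator arr \<beta> ?L \<eta> \<le> (\<Sum>p\<in>UNIV. a p * (- \<epsilon> * lam + n * lam * r))
      + (\<Sum>v\<in>UNIV. \<Sum>p\<in>UNIV. a p * (- \<epsilon> * (service_increment p v (\<eta> v) + route v (hd (\<eta> v)) p) + r))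
      + \<beta> * (\<Sum>e\<in>G. \<Sum>p\<in>UNIV. a p * (- \<epsilon> * swap_increment p e \<eta> + r))"
    unfolding generator_def all G_def
    by (intro add_mono sum_mono mult_left_mono arrival service swap beta_nonneg)
  also have "\<dots> = (\<Sum>p\<in>UNIV. a p * ((- \<epsilon> * lam + n * lam * r)
      + (\<Sum>v\<in>UNIV. - \<epsilon> * (service_increment p v (\<eta> v) + route v (hd (\<eta> v)) p) + r)
      + \<beta> * (\<Sum>e\<in>G. - \<epsilon> * swap_increment p e \<eta> + r)))"
  proof -
    have "(\<Sum>v\<in>UNIV. \<Sum>p\<in>UNIV. a p * (- \<epsilon> * (service_increment p v (\<eta> v) + route v (hd (\<eta> v)) p) + r))
        = (\<Sum>p\<in>UNIV. a p * (\<Sum>v\<in>UNIV. - \<epsilon> * (service_increment p v (\<eta> v) + route v (hd (\<eta> v)) p) + r))"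
      by (subst sum.swap) (simp only: sum_distrib_left)
    moreover have "\<beta> * (\<Sum>e\<in>G. \<Sum>p\<in>UNIV. a p * (- \<epsilon> * swap_increment p e \<eta> + r))
        = (\<Sum>p\<in>UNIV. a p * (\<beta> * (\<Sum>e\<in>G. - \<epsilon> * swap_increment p e \<eta> + r)))"
      by (subst sum.swap) (simp only: sum_distrib_left mult.left_commute)
    ultimately show ?thesis
      by (simp only: distrib_left[of "a _"] sum.distrib)
  qed
  also have "\<dots> = (\<Sum>p\<in>UNIV. a p * (- \<epsilon> * drift p \<eta> + (n * lam + n + \<beta> * card G) * r))"
  proof (intro sum.cong refl arg_cong[where f = "\<lambda>x. a _ * x"])
    fix p
    have s1: "(\<Sum>v\<in>UNIV. - \<epsilon> * (service_increment p v (\<eta> v) + route v (hd (\<eta> v)) p) + r)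
        = - \<epsilon> * (\<Sum>v\<in>UNIV. service_increment p v (\<eta> v) + route v (hd (\<eta> v)) p) + n * r"
      by (simp only: sum.distrib[of _ "\<lambda>_. r"] sum_distrib_left[of "- \<epsilon>"] sum_constant n_def)
    have s2: "(\<Sum>e\<in>G. - \<epsilon> * swap_increment p e \<eta> + r)
        = - \<epsilon> * (\<Sum>e\<in>G. swap_increment p e \<eta>) + card G * r"
      by (simp only: sum.distrib[of _ "\<lambda>_. r"] sum_distrib_left[of "- \<epsilon>"] sum_constant)
    show "- \<epsilon> * lam + n * lam * r
        + (\<Sum>v\<in>UNIV. - \<epsilon> * (service_increment p v (\<eta> v) + route v (hd (\<eta> v)) p) + r)
        + \<beta> * (\<Sum>e\<in>G. - \<epsilon> * swap_increment p e \<eta> + r)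
        = - \<epsilon> * drift p \<eta> + (n * lam + n + \<beta> * card G) * r"
      unfolding s1 s2 drift_def G_def[symmetric] by (simp add: algebra_simps)
  qed
  finally show ?thesis
    unfolding a_def n_def G_def r_def .
qed


lemma generator_lyapunov_neg:
  assumes "lam > 0" and "\<delta> \<ge> 0"
    and drift: "lam - 1 + (real CARD(('k, 'l) torus) - 1) * m0 - real CARD(('k, 'l) torus) * \<delta> > 0"
  obtains \<epsilon> where "\<epsilon> > 0"
    and "\<forall>\<eta>. (\<forall>v. M < length (\<eta> v)) \<longrightarrow> generator arr \<beta> (lyapunov \<epsilon>) \<eta> < 0"
proof -
  define \<kappa> where "\<kappa> = lam - 1 + (real CARD(('k, 'l) torus) - 1) * m0 - real CARD(('k, 'l) torus) * \<delta>"
  define \<Lambda> where "\<Lambda> = real CARD(('k, 'l) torus) * lam + real CARD(('k, 'l) torus)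
    + \<beta> * card (torus_edges :: ('k, 'l) torus set set)"
  define B where "B = increment_bound"
  have "\<kappa> > 0" using drift by (simp only: \<kappa>_def)
  have "B > 0" using increment_bound_ge(1) MC_nonneg unfolding B_def by linarith
  have n: "real CARD(('k, 'l) torus) > 0"
    by (simp only: of_nat_0_less_iff zero_less_card_finite)
  have "\<Lambda> > 0"
    using mult_pos_pos[OF n \<open>lam > 0\<close>] n mult_nonneg_nonneg[OF beta_nonneg, of "card (torus_edges :: ('k, 'l) torus set set)"]
    unfolding \<Lambda>_def by linarith
  \<comment> \<open>The first entry keeps all increments in the range of
    \<open>exp_increment_le\<close>; the second makes the quadratic error at most half of the gain
    \<open>\<epsilon> * \<kappa>\<close>.\<close>
  define \<epsilon> where "\<epsilon> = min (1 / B) (\<kappa> / (2 * B\<^sup>2 * \<Lambda>))"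
  have "\<epsilon> > 0"
    using \<open>\<kappa> > 0\<close> \<open>B > 0\<close> \<open>\<Lambda> > 0\<close> by (simp add: \<epsilon>_def)
  have "\<epsilon> \<le> 1 / B" by (simp add: \<epsilon>_def)
  then have \<epsilon>B: "\<epsilon> * increment_bound \<le> 1"
    using \<open>B > 0\<close> unfolding B_def[symmetric] by (simp add: pos_le_divide_eq)
  have "\<epsilon> \<le> \<kappa> / (2 * B\<^sup>2 * \<Lambda>)" by (simp add: \<epsilon>_def)
  then have "\<epsilon> * (2 * B\<^sup>2 * \<Lambda>) \<le> \<kappa>"
    using \<open>B > 0\<close> \<open>\<Lambda> > 0\<close> by (simp add: pos_le_divide_eq)
  then have "\<epsilon> * (\<epsilon> * (2 * B\<^sup>2 * \<Lambda>)) \<le> \<epsilon> * \<kappa>"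
    using \<open>\<epsilon> > 0\<close> by (intro mult_left_mono) auto
  then have small: "2 * (\<Lambda> * (\<epsilon> * B)\<^sup>2) \<le> \<epsilon> * \<kappa>"
    by (simp add: power2_eq_square algebra_simps)
  show thesis
  proof (rule that[OF \<open>\<epsilon> > 0\<close>], intro allI impI)
    fix \<eta> :: "('k, 'l) config" assume "\<forall>v. M < length (\<eta> v)"
    then have len: "M < length (\<eta> v)" for v by blast
    have "generator arr \<beta> (lyapunov \<epsilon>) \<eta>
        \<le> (\<Sum>p\<in>UNIV. exp (- \<epsilon> * potential p \<eta>) * (- \<epsilon> * drift p \<eta> + \<Lambda> * (\<epsilon> * B)\<^sup>2))"
      unfolding \<Lambda>_def B_def by (rule generator_lyapunov_le[OF \<open>\<epsilon> > 0\<close> \<epsilon>B len])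
    also have "\<dots> < (\<Sum>p\<in>(UNIV :: ('k, 'l) torus set). 0)"
    proof (rule sum_strict_mono)
      fix p
      have "\<epsilon> * drift p \<eta> \<ge> \<epsilon> * \<kappa>"
        using drift_ge[OF len \<open>\<delta> \<ge> 0\<close>, of p] \<open>\<epsilon> > 0\<close> unfolding \<kappa>_def by (intro mult_left_mono) auto
      moreover have "\<epsilon> * \<kappa> > 0"
        using \<open>\<epsilon> > 0\<close> \<open>\<kappa> > 0\<close> by simp
      ultimately have "- \<epsilon> * drift p \<eta> + \<Lambda> * (\<epsilon> * B)\<^sup>2 < 0"
        using small by linarith
      then show "exp (- \<epsilon> * potential p \<eta>) * (- \<epsilon> * drift p \<eta> + \<Lambda> * (\<epsilon> * B)\<^sup>2) < 0"
        by (simp only: mult_pos_neg exp_gt_zero)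
    qed auto
    finally show "generator arr \<beta> (lyapunov \<epsilon>) \<eta> < 0"
      by simp
  qed
qed

text \<open>A single queue of length at most \<open>M\<close> makes its own summand at least as
  large as the threshold.\<close>

lemma long_queues_if_lyapunov_small:
  assumes "\<epsilon> > 0"
    and small: "lyapunov \<epsilon> \<eta> < exp (- \<epsilon> * (M + real CARD(('k, 'l) torus) * (M * C)))"
  shows "M < length (\<eta> v)"
proof (rule ccontr)
  assume "\<not> M < length (\<eta> v)"
  then have "potential v \<eta> \<le> M + real CARD(('k, 'l) torus) * (M * C)"
    using abs_potential_minus_length_le[of v \<eta>] by linarith
  then have "exp (- \<epsilon> * (M + real CARD(('k, 'l) torus) * (M * C))) \<le> exp (- \<epsilon> * potential v \<eta>)"
    using \<open>\<epsilon> > 0\<close> by (simp only: exp_le_cancel_iff mult_minus_left neg_le_iff_le mult_le_cancel_left_pos)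
  also have "\<dots> \<le> lyapunov \<epsilon> \<eta>"
    unfolding lyapunov_def by (intro member_le_sum[where f = "\<lambda>p. exp (- \<epsilon> * potential p \<eta>)"]) auto
  finally show False
    using small by linarith
qed

lemma lyapunov_small_if_long_queues:
  assumes "\<epsilon> > 0" and "c > 0"
  obtains N where "\<forall>\<eta>. (\<forall>v. N \<le> length (\<eta> v)) \<longrightarrow> lyapunov \<epsilon> \<eta> < c"
proof -
  define n where "n = real CARD(('k, 'l) torus)"
  have "n > 0"
    unfolding n_def by (simp only: of_nat_0_less_iff zero_less_card_finite)
  \<comment> \<open>Obtained by solving
    \<open>n * exp (- \<epsilon> * (N - n * (M * C))) < c\<close> for \<open>N\<close>.\<close>
  obtain N :: nat where N: "real N > n * (M * C) + (ln n - ln c) / \<epsilon>"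
    using reals_Archimedean2 by blast
  show thesis
  proof (rule that, intro allI impI)
    fix \<eta> :: "('k, 'l) config" assume len: "\<forall>v. N \<le> length (\<eta> v)"
    have "lyapunov \<epsilon> \<eta> \<le> (\<Sum>p\<in>(UNIV :: ('k, 'l) torus set). exp (- \<epsilon> * (N - n * (M * C))))"
      unfolding lyapunov_def
    proof (rule sum_mono)
      fix p
      have "N - n * (M * C) \<le> potential p \<eta>"
        using abs_potential_minus_length_le[of p \<eta>] spec[OF len, of p] unfolding n_def by linarith
      then show "exp (- \<epsilon> * potential p \<eta>) \<le> exp (- \<epsilon> * (N - n * (M * C)))"
        using \<open>\<epsilon> > 0\<close> by (simp only: exp_le_cancel_iff mult_minus_left neg_le_iff_le mult_le_cancel_left_pos)
    qed
    also have "\<dots> = n * exp (- \<epsilon> * (N - n * (M * C)))"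
      unfolding n_def by (rule sum_constant)
    also have "\<dots> = exp (ln n - \<epsilon> * (N - n * (M * C)))"
      using \<open>n > 0\<close> by (simp add: exp_diff exp_minus divide_inverse)
    also have "\<dots> < exp (ln c)"
    proof -
      have "(ln n - ln c) / \<epsilon> < N - n * (M * C)"
        using N by linarith
      then have "ln n - ln c < \<epsilon> * (N - n * (M * C))"
        using \<open>\<epsilon> > 0\<close> by (simp only: pos_divide_less_eq mult.commute)
      then show ?thesis
        by (simp only: exp_less_cancel_iff)
    qed
    finally show "lyapunov \<epsilon> \<eta> < c"
      using \<open>c > 0\<close> by simp
  qed
qed

end

text \<open>Only arrivals are followed, one node after the other. They shorten no queue, so the
  nodes already treated stay long; \<open>w v\<close> is a destination that occurs at
  \<open>v\<close> with positive rate.\<close>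

lemma network_reaches_long_queues:
  fixes arr :: "('k::nontriv, 'l::nontriv) torus \<Rightarrow> ('k, 'l) torus \<Rightarrow> real"
  assumes nonneg: "\<And>v w. arr v w \<ge> 0" and \<beta>: "\<beta> \<ge> 0" and pos: "\<And>v. arr v (w v) > 0"
  shows "\<exists>m. \<exists>\<zeta>\<in>set_pmf (chain_law (jump_pmf (network_rate arr \<beta>)) \<eta> m). \<forall>v. N \<le> length (\<zeta> v)"
proof -
  define R where "R = (\<Union>m. set_pmf (chain_law (jump_pmf (network_rate arr \<beta>)) \<eta> m))"
  have start: "\<eta> \<in> R"
    unfolding R_def by (rule UN_I[of 0]) simp_all
  have step: "\<zeta>(v := \<zeta> v @ [w v]) \<in> R" if \<zeta>: "\<zeta> \<in> R" for \<zeta> v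
  proof -
    obtain m where m: "\<zeta> \<in> set_pmf (chain_law (jump_pmf (network_rate arr \<beta>)) \<eta> m)"
      using \<zeta> unfolding R_def by blast
    define \<xi> where "\<xi> = \<zeta>(v := \<zeta> v @ [w v])"
    have "\<xi> v \<noteq> \<zeta> v" by (simp add: \<xi>_def)
    then have "\<xi> \<noteq> \<zeta>" by metis
    moreover have "network_rate arr \<beta> \<zeta> \<xi> > 0"
      unfolding \<xi>_def using nonneg \<beta> pos by (rule network_rate_arrival_pos)
    moreover note exit = exit_rate_network_pos[of arr \<beta> v "w v" \<zeta>, OF nonneg \<beta> pos]
    ultimately have "\<xi> \<in> set_pmf (jump_pmf (network_rate arr \<beta>) \<zeta>)"
      by (simp add: set_pmf_iff pmf_jump_network[of arr \<beta> \<zeta>, OF nonneg \<beta> exit])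
    then have "\<xi> \<in> set_pmf (chain_law (jump_pmf (network_rate arr \<beta>)) \<eta> (Suc m))"
      using m by auto
    then show ?thesis
      unfolding R_def \<xi>_def by blast
  qed
  have one: "\<exists>\<xi>\<in>R. j \<le> length (\<xi> v) \<and> (\<forall>u. length (\<zeta> u) \<le> length (\<xi> u))" if "\<zeta> \<in> R" for \<zeta> v j
  proof (induction j)
    case 0
    show ?case using that by (intro bexI[of _ \<zeta>]) auto
  next
    case (Suc j)
    then obtain \<xi> where \<xi>: "\<xi> \<in> R" "j \<le> length (\<xi> v)" "\<And>u. length (\<zeta> u) \<le> length (\<xi> u)"
      by blast
    have "length (\<zeta> u) \<le> length ((\<xi>(v := \<xi> v @ [w v])) u)" for u
      using \<xi>(3)[of u] by (cases "u = v") simp_all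
    with \<xi> step[OF \<xi>(1), of v] show ?case
      by (intro bexI[of _ "\<xi>(v := \<xi> v @ [w v])"]) auto
  qed
  have "\<exists>\<zeta>\<in>R. \<forall>v\<in>S. N \<le> length (\<zeta> v)" if "finite S" for S
    using that
  proof (induction S rule: finite_induct)
    case empty
    then show ?case using start by blast
  next
    case (insert v S)
    then obtain \<zeta> where \<zeta>: "\<zeta> \<in> R" "\<forall>v\<in>S. N \<le> length (\<zeta> v)"
      by blast
    obtain \<xi> where "\<xi> \<in> R" "N \<le> length (\<xi> v)" "\<forall>u. length (\<zeta> u) \<le> length (\<xi> u)"
      using one[OF \<zeta>(1), of N v] by blast
    with \<zeta>(2) show ?case
      by (intro bexI[of _ \<xi>]) (auto intro: order_trans)
  qed
  from this[of UNIV] show ?thesis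
    unfolding R_def by auto
qed

lemma expectation_less_const:
  fixes g :: "'a \<Rightarrow> real"
  assumes fin: "finite (set_pmf p)" and le: "\<And>x. g x \<le> c" and z: "z \<in> set_pmf p" "g z < c"
  shows "measure_pmf.expectation p g < c"
proof -
  have "measure_pmf.expectation p g = (\<Sum>x\<in>set_pmf p. pmf p x * g x)"
    by (subst integral_measure_pmf[OF fin]) auto
  also have "\<dots> < (\<Sum>x\<in>set_pmf p. pmf p x * c)"
    using z le by (intro sum_strict_mono_ex1[OF fin] ballI mult_left_mono bexI[of _ z])
      (auto simp: pmf_positive)
  also have "\<dots> = c"
    by (simp add: sum_distrib_right[symmetric] sum_pmf_eq_1[OF fin order_refl])
  finally show ?thesis .
qed

lemma (in queue_lyapunov) transient_network:
  assumes "lam > 0" and "\<delta> \<ge> 0"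
    and drift: "lam - 1 + (real CARD(('k, 'l) torus) - 1) * m0 - real CARD(('k, 'l) torus) * \<delta> > 0"
  shows "transient_ctmc (network_rate arr \<beta>)"
proof -
  let ?q = "network_rate arr \<beta>"
  obtain \<epsilon> where "\<epsilon> > 0"
    and gen: "\<forall>\<eta>. (\<forall>v. M < length (\<eta> v)) \<longrightarrow> generator arr \<beta> (lyapunov \<epsilon>) \<eta> < 0"
    by (rule generator_lyapunov_neg[OF assms])
  define f where "f = lyapunov \<epsilon>"
  \<comment> \<open>The threshold of \<open>long_queues_if_lyapunov_small\<close>: below it the
    generator of \<open>f\<close> is negative.\<close>
  define c where "c = exp (- \<epsilon> * (M + real CARD(('k, 'l) torus) * (M * C)))"
  define g where "g \<eta> = min (f \<eta>) c" for \<eta>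
  have "\<exists>w. arr v w > 0" for v
  proof (rule ccontr)
    assume "\<nexists>w. arr v w > 0"
    then have "(\<Sum>w\<in>UNIV. arr v w) \<le> 0"
      by (intro sum_nonpos) (auto simp: not_less)
    then show False
      using sum_arr[of v] \<open>lam > 0\<close> by simp
  qed
  then obtain w where w: "\<And>v. arr v (w v) > 0"
    by metis
  have exit: "exit_rate ?q \<eta> > 0" for \<eta>
    by (rule exit_rate_network_pos[of arr \<beta> undefined "w undefined", OF arr_nonneg beta_nonneg w])
  note fin = finite_set_jump_network[of arr \<beta>, OF arr_nonneg beta_nonneg exit]
  have E_low: "measure_pmf.expectation (jump_pmf ?q \<eta>) g < g \<eta>" if "f \<eta> < c" for \<eta>
  proof -
    have len: "M < length (\<eta> v)" for v
      using long_queues_if_lyapunov_small[OF \<open>\<epsilon> > 0\<close>] that unfolding f_def c_def by blast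
    have "measure_pmf.expectation (jump_pmf ?q \<eta>) g \<le> measure_pmf.expectation (jump_pmf ?q \<eta>) f"
      by (intro integral_mono integrable_measure_pmf_finite fin) (simp add: g_def)
    also have "\<dots> = f \<eta> + generator arr \<beta> f \<eta> / exit_rate ?q \<eta>"
      by (rule expectation_jump_network[of arr \<beta>, OF arr_nonneg beta_nonneg exit])
    also have "\<dots> < f \<eta>"
      using gen len exit[of \<eta>] unfolding f_def[symmetric] by (simp add: divide_neg_pos)
    finally show ?thesis
      using that by (simp add: g_def)
  qed
  \<comment> \<open>Where \<open>f\<close> is at least \<open>c\<close>, the function
    \<open>g\<close> takes its maximal value \<open>c\<close>, so this bound is superharmonicity
    there.\<close>
  have E_le_c: "measure_pmf.expectation (jump_pmf ?q \<eta>) g \<le> c" for \<eta>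
    by (intro measure_pmf.integral_le_const integrable_measure_pmf_finite fin AE_I2) (simp add: g_def)
  show ?thesis
  proof (rule transient_ctmcI[where g = g])
    show "0 \<le> g \<eta>" for \<eta>
      by (simp add: g_def f_def c_def lyapunov_def sum_nonneg)
    show "measure_pmf.expectation (jump_pmf ?q \<eta>) g \<le> g \<eta>" for \<eta>
      using E_low[of \<eta>] E_le_c[of \<eta>] by (cases "f \<eta> < c") (simp_all add: g_def)
    show "\<exists>m. measure_pmf.expectation (chain_law (jump_pmf ?q) \<eta> m) g < g \<eta>" for \<eta>
    proof (cases "f \<eta> < c")
      case True
      then have "measure_pmf.expectation (chain_law (jump_pmf ?q) \<eta> (Suc 0)) g < g \<eta>"
        using E_low[OF True] by (simp add: bind_return_pmf)
      then show ?thesis ..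
    next
      case False
      have "c > 0" by (simp add: c_def)
      obtain N where N: "\<forall>\<zeta>. (\<forall>v. N \<le> length (\<zeta> v)) \<longrightarrow> f \<zeta> < c"
        unfolding f_def by (rule lyapunov_small_if_long_queues[OF \<open>\<epsilon> > 0\<close> \<open>c > 0\<close>])
      obtain m \<zeta> where \<zeta>: "\<zeta> \<in> set_pmf (chain_law (jump_pmf ?q) \<eta> m)" "\<forall>v. N \<le> length (\<zeta> v)"
        using network_reaches_long_queues[of arr \<beta> w \<eta> N, OF arr_nonneg beta_nonneg w] by blast
      have "measure_pmf.expectation (chain_law (jump_pmf ?q) \<eta> m) g < c"
      proof (rule expectation_less_const[OF finite_set_pmf_chain_law[OF fin] _ \<zeta>(1)])
        show "g \<zeta> < c"
          using N \<zeta>(2) unfolding g_def min_less_iff_disj by blast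
      qed (simp add: g_def)
      then show ?thesis
        using False by (auto simp: g_def)
    qed
  qed (use exit fin in auto)
qed

section \<open>Construction of the correction and conclusion\<close>

lemma card_off_diagonal:
  "real (card {x :: 'v::finite \<times> 'v. fst x \<noteq> snd x}) = real CARD('v) * (real CARD('v) - 1)"
proof -
  have "{x :: 'v \<times> 'v. fst x \<noteq> snd x} = (SIGMA p:UNIV. - {p})"
    by auto
  moreover have "real (card (- {p :: 'v})) = real CARD('v) - 1" for p
    unfolding Compl_eq_Diff_UNIV by (subst card_Diff_singleton) (auto simp: of_nat_diff Suc_leI)
  ultimately show ?thesis
    by (simp add: card_SigmaI)
qed

text \<open>A choice function \<open>R\<close> for the resolvent is iterated, separately for each
  destination.\<close>

lemma iterated_resolvents:
  fixes f :: "'d \<Rightarrow> 'v::finite \<times> 'v \<Rightarrow> real"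
  assumes "\<beta> \<ge> 0"
  shows "\<exists>h :: nat \<Rightarrow> 'd \<Rightarrow> 'v \<times> 'v \<Rightarrow> real. h 0 = f \<and> (\<forall>i d x. h i d x = h (Suc i) d x
      + \<beta> * (\<Sum>e\<in>E. h (Suc i) d x - h (Suc i) d (map_prod (edge_swap e) (edge_swap e) x)))"
proof -
  have inv: "map_prod (edge_swap e) (edge_swap e) (map_prod (edge_swap e) (edge_swap e) x) = x"
    for e and x :: "'v \<times> 'v"
    by (cases x) simp
  have "\<exists>g. \<forall>x. f x = g x + \<beta> * (\<Sum>e\<in>E. g x - g (map_prod (edge_swap e) (edge_swap e) x))"
    for f :: "'v \<times> 'v \<Rightarrow> real"
    by (rule resolvent_exists[where T = "\<lambda>e. map_prod (edge_swap e) (edge_swap e)", OF inv assms])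
  then obtain R where R: "\<And>f x. f x = R f x + \<beta> * (\<Sum>e\<in>E. R f x - R f (map_prod (edge_swap e) (edge_swap e) x))"
    by metis
  show ?thesis
  proof (intro exI[of _ "\<lambda>i d. (R ^^ i) (f d)"] conjI allI)
    show "(\<lambda>d. (R ^^ 0) (f d)) = f" by simp
    show "(R ^^ i) (f d) x = (R ^^ Suc i) (f d) x
      + \<beta> * (\<Sum>e\<in>E. (R ^^ Suc i) (f d) x - (R ^^ Suc i) (f d) (map_prod (edge_swap e) (edge_swap e) x))" for i d x
      unfolding funpow.simps o_apply by (rule R)
  qed
qed

theorem theorem10:
  fixes arr :: "('k::nontriv, 'l::nontriv) torus \<Rightarrow> ('k, 'l) torus \<Rightarrow> real"
    and lam \<beta> :: real
  assumes "odd CARD('k)" and "CARD('k) \<ge> 3"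
    and "odd CARD('l)" and "CARD('l) \<ge> 3"
    and "lam > 0" and "\<beta> > 0"
    and "\<And>v w. arr v w \<ge> 0"
    and "\<And>v w v' w'. w - v = w' - v' \<Longrightarrow> arr v w = arr v' w'"
    and "\<And>v. (\<Sum>w\<in>UNIV. arr v w) = lam"
    and "real CARD('k) * real CARD('l) > 5 / lam"
  shows "transient_ctmc (network_rate arr \<beta>)"
proof -
  define n where "n = real CARD(('k, 'l) torus)"
  have n: "n = real CARD('k) * real CARD('l)"
    by (simp add: n_def)
  have "3 * 3 \<le> CARD('k) * CARD('l)"
    using assms(2,4) by (rule mult_le_mono)
  then have "real 9 \<le> real (CARD('k) * CARD('l))"
    by (simp only: of_nat_le_iff)
  then have "n \<ge> 9"
    by (simp add: n)
  have "lam > 5 / n"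
    using assms(10) \<open>lam > 0\<close> \<open>n \<ge> 9\<close> unfolding n[symmetric] by (simp add: field_simps)
  \<comment> \<open>The total \<open>n - 5\<close> from \<open>sum_route_pairs\<close> averaged over
    the \<open>n * (n - 1)\<close> ordered pairs, so that level 0 of \<psi> is centered.\<close>
  define m0 where "m0 = (n - 5) / (n * (n - 1))"
  \<comment> \<open>Chosen so that the loss \<open>n * \<delta>\<close> in \<open>drift_ge\<close>
    is half of the surplus \<open>lam - 5 / n\<close>.\<close>
  define \<delta> where "\<delta> = (lam - 5 / n) / (2 * n)"
  have "\<delta> > 0"
    using \<open>lam > 5 / n\<close> \<open>n \<ge> 9\<close> by (simp add: \<delta>_def)
  from iterated_resolvents[OF less_imp_le[OF \<open>\<beta> > 0\<close>],
      of "\<lambda>d x. route (snd x) d (fst x) - m0" "torus_edges :: ('k, 'l) torus set set"]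
  obtain \<psi> :: "nat \<Rightarrow> ('k, 'l) torus \<Rightarrow> ('k, 'l) torus \<times> ('k, 'l) torus \<Rightarrow> real"
    where \<psi>: "\<psi> 0 = (\<lambda>d x. route (snd x) d (fst x) - m0) \<and>
      (\<forall>i d x. \<psi> i d x = \<psi> (Suc i) d x + \<beta> * (\<Sum>e\<in>torus_edges.
        \<psi> (Suc i) d x - \<psi> (Suc i) d (map_prod (edge_swap e) (edge_swap e) x)))"
    by (elim exE)
  note \<psi>_0 = conjunct1[OF \<psi>] and \<psi>_Suc = conjunct2[OF \<psi>, rule_format]
  have lim: "(\<lambda>i. \<psi> i d x) \<longlonglongrightarrow> 0" if "fst x \<noteq> snd x" for d x
  proof (rule iterated_pair_resolvent_tendsto_0[where h = "\<lambda>i. \<psi> i d", OF _ \<open>\<beta> > 0\<close> \<psi>_Suc _ that])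
    show "(a, b) \<in> {(x, y). {x, y} \<in> torus_edges}\<^sup>*" for a b :: "('k, 'l) torus"
      unfolding torus_edges_iff by (rule torus_connected)
    have "(\<Sum>x | fst x \<noteq> snd x. route (snd x) d (fst x) - m0) = (n - 5) - n * (n - 1) * m0"
      by (simp only: sum_subtractf sum_route_pairs[OF assms(2,4)] sum_constant card_off_diagonal n_def)
    also have "\<dots> = 0"
      using \<open>n \<ge> 9\<close> by (simp add: m0_def)
    finally show "(\<Sum>x | fst x \<noteq> snd x. \<psi> 0 d x) = 0"
      unfolding \<psi>_0 .
  qed
  have "eventually (\<lambda>i. fst x \<noteq> snd x \<longrightarrow> \<bar>\<psi> i d x\<bar> \<le> \<delta>) sequentially" for d x
  proof (cases "fst x \<noteq> snd x")
    case True
    show ?thesis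
      using tendstoD[OF lim[OF True, of d] \<open>\<delta> > 0\<close>] by eventually_elim simp
  qed simp
  \<comment> \<open>There are finitely many destinations and pairs, so one depth serves them
    all.\<close>
  then have "eventually (\<lambda>i. \<forall>d x. fst x \<noteq> snd x \<longrightarrow> \<bar>\<psi> i d x\<bar> \<le> \<delta>) sequentially"
    by (intro eventually_all_finite)
  then obtain M where M: "\<And>d x. fst x \<noteq> snd x \<Longrightarrow> \<bar>\<psi> M d x\<bar> \<le> \<delta>"
    unfolding eventually_sequentially by blast
  \<comment> \<open>Diagonal pairs, where no convergence is claimed, are included here because
    \<open>psi_bound\<close> ranges over all pairs.\<close>
  define C where "C = Max ((\<lambda>(i, d, x). \<bar>\<psi> i d x\<bar>) ` ({..M} \<times> UNIV \<times> UNIV))"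
  interpret queue_lyapunov arr \<beta> lam m0 C \<delta> \<psi> M
  proof
    show "\<psi> 0 d (p, k) = route k d p - m0" if "p \<noteq> k" for d p k
      by (simp add: \<psi>_0)
    show "\<bar>\<psi> i d x\<bar> \<le> C" if "i \<le> M" for i d x
      unfolding C_def using that by (intro Max_ge image_eqI[where x = "(i, d, x)"]) auto
    show "\<bar>\<psi> M d (p, k)\<bar> \<le> \<delta>" if "p \<noteq> k" for d p k
      using M[of "(p, k)" d] that by simp
  qed (fact assms(7) assms(9) less_imp_le[OF assms(6)] \<psi>_Suc)+
  \<comment> \<open>Here \<open>(n - 1) * m0\<close> equals \<open>1 - 5 / n\<close>: the inflow
    from the other queues offsets the service at \<open>p\<close> up to
    \<open>5 / n\<close>.\<close>
  have "lam - 1 + (n - 1) * m0 - n * \<delta> = (lam - 5 / n) / 2"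
    using \<open>n \<ge> 9\<close> by (simp add: m0_def \<delta>_def field_simps)
  then show ?thesis
    using \<open>lam > 5 / n\<close> \<open>\<delta> > 0\<close> \<open>lam > 0\<close> unfolding n_def by (intro transient_network) auto
qed

end
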